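(* Let $\{B(t)\}_{t\ge 0}$ be a standard Brownian motion on $\mathbf{R}$. With probability one, $$\lim_{t\to\infty} \frac{\mathcal{L}_2 t}{\mathcal{L}_3 t} \left( \sup_{s\ge t} \frac{B(s)}{\sqrt{2s\, \mathcal{L}_2 s}} -1 \right) = \frac34.$$
   Context: $\mathcal{L}_k x$ denotes the $k$-fold iterated natural logarithm: $\mathcal{L}_2 x=\ln\ln x$, $\mathcal{L}_3 x=\ln\ln\ln x$; all expressions are considered for $t$ large enough that they are defined. *)

theory Defs
  imports "HOL-Probability.Probability"
begin

text \<open>
  Measurability of the increments over \<open>s < t\<close> and their law \<open>N(0, t - s)\<close> are both part of
  \<^const>\<open>distributed\<close>; the second parameter of \<^const>\<open>normal_density\<close> is the standard deviation.
  The conditions on the starting point and on the paths are only required almost surely.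
\<close>

locale standard_brownian_motion = prob_space M
  for M :: "'a measure" and B :: "real \<Rightarrow> 'a \<Rightarrow> real" +
  assumes measurable_BM: "\<And>t. 0 \<le> t \<Longrightarrow> B t \<in> borel_measurable M"
    and start_zero: "AE \<omega> in M. B 0 \<omega> = 0"
    and indep_increments:
      "\<And>(\<tau> :: nat \<Rightarrow> real) n. 0 \<le> \<tau> 0 \<Longrightarrow> (\<And>i. i < n \<Longrightarrow> \<tau> i < \<tau> (Suc i)) \<Longrightarrow>
        indep_vars (\<lambda>_. borel) (\<lambda>i \<omega>. B (\<tau> (Suc i)) \<omega> - B (\<tau> i) \<omega>) {..<n}"
    and normal_increments:
      "\<And>s t. 0 \<le> s \<Longrightarrow> s < t \<Longrightarrow>
        distributed M lborel (\<lambda>\<omega>. B t \<omega> - B s \<omega>) (normal_density 0 (sqrt (t - s)))"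
    and continuous_paths: "AE \<omega> in M. continuous_on {0..} (\<lambda>t. B t \<omega>)"

definition iterated_ln :: "nat \<Rightarrow> real \<Rightarrow> real" where
  "iterated_ln k = ln ^^ k"

end

theory Submission
  imports Defs "HOL-Real_Asymp.Real_Asymp"
begin

text \<open>
  Write \<open>x = ln (ln s)\<close> for the scale of a time \<open>s\<close>. At a single time, \<open>B s\<close> exceeds
  \<open>(1 + c * ln x / x) * sqrt (2 * s * x)\<close> with probability about
  \<open>x powr (- 1/2) * exp (- x - 2 * c * ln x) = x powr (- 1/2 - 2 * c) / ln s\<close>. After such an
  excess the path needs a time of order \<open>s / x\<close> to forget it, so a unit of \<open>ln s\<close> holds about \<open>x\<close>
  nearly independent trials. The scales \<open>m \<le> x \<le> m + 1\<close> cover a stretch of \<open>ln s\<close> of length about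
  \<open>exp m\<close>, and so the expected number of excesses on them is about \<open>m powr (1/2 - 2 * c)\<close>. The sum
  of these numbers over \<open>m\<close> converges for \<open>c > 3/4\<close> and diverges for \<open>c < 3/4\<close>.

  For \<open>c > 3/4\<close> this is a union bound and the Borel--Cantelli lemma
  (\<open>AE_eventually_blockwise_upper\<close>). Both powers of \<open>x\<close> matter here. The power \<open>- 1/2\<close> comes from
  the Gaussian tail, and the number of trials is right only if the supremum of the path over a time
  interval of length \<open>s / x\<close> costs no more than its value at the right end, up to a constant. The
  reflection principle gives this with the constant 2 (\<open>sup_tail_le\<close>).

  For \<open>c < 3/4\<close> the expected number of excesses on one unit of scale may tend to 0, so an excess
  cannot be asked for at every unit. But the supremum over all later times only has to see one
  excess at a comparable scale. On the longer stretch \<open>m \<le> x \<le> \<eta> * m\<close> with \<open>\<eta> > 1\<close>, the excess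
  \<open>c * ln m / m\<close> measured at its left end is reached, up to logarithmic factors, at least
  \<open>m powr (3/2 - 2 * c * \<eta>)\<close> times on average, which is a positive power of \<open>m\<close> if
  \<open>c * \<eta> < 3/4\<close>. To exploit independence, time is cut at \<open>T q = m ^ (4 *
  q)\<close>. On the right half of a block, replacing \<open>B s\<close> by the increment \<open>B
  s - B (T q)\<close> costs at most of order \<open>sqrt s / m\<close>, which is too little to
  matter, and the increments over different blocks are independent. The probability that no block
  has an excess is then at most the exponential of minus a power of \<open>m\<close>, which is
  summable (\<open>AE_eventually_blockwise_lower\<close>). Within one block, the excesses at well
  separated times are nearly disjoint events, so that the probability of their union is at least
  half the sum of their probabilities (\<open>block_prob_ge\<close>).

  Both statements hold almost surely for countably many \<open>c\<close> on either side of \<open>3/4\<close>, and the limit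
  follows path by path.
\<close>

section \<open>Gaussian tails and windows\<close>

context prob_space begin

text \<open>
  On \<open>[y * \<sigma>, \<infinity>)\<close> the density is dominated by its product with \<open>x / (y * \<sigma>)\<close>, which has
  an elementary primitive. The factor \<open>1 / y\<close> is essential: without it the upper bound of the
  theorem would come out as 1 instead of \<open>3/4\<close>.
\<close>

lemma normal_tail_le:
  assumes X: "distributed M lborel X (normal_density 0 \<sigma>)" and \<sigma>: "0 < \<sigma>" and y: "0 < y"
  shows "prob {\<omega> \<in> space M. y * \<sigma> \<le> X \<omega>} \<le> exp (- y\<^sup>2 / 2) / y"
proof -
  define f where "f x = x / (y * \<sigma>) * normal_density 0 \<sigma> x" for x
  define F where "F x = - (\<sigma> / y) * normal_density 0 \<sigma> x" for x
  have [measurable]: "X \<in> borel_measurable M"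
    using X by (simp add: distributed_def)
  have "emeasure M (X -` {y * \<sigma>..} \<inter> space M)
      = (\<integral>\<^sup>+x. ennreal (normal_density 0 \<sigma> x) * indicator {y * \<sigma>..} x \<partial>lborel)"
    by (rule distributed_emeasure[OF X]) simp
  also have "\<dots> \<le> (\<integral>\<^sup>+x. ennreal (f x) * indicator {y * \<sigma>..} x \<partial>lborel)"
  proof (intro nn_integral_mono)
    fix x :: real
    have "normal_density 0 \<sigma> x \<le> f x" if "y * \<sigma> \<le> x"
    proof -
      have "1 \<le> x / (y * \<sigma>)" using that \<sigma> y by simp
      then show ?thesis
        unfolding f_def using mult_right_mono[of 1 "x / (y * \<sigma>)" "normal_density 0 \<sigma> x"] by simp
    qed
    then show "ennreal (normal_density 0 \<sigma> x) * indicator {y * \<sigma>..} x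
        \<le> ennreal (f x) * indicator {y * \<sigma>..} x"
      by (auto simp: indicator_def intro!: ennreal_leI)
  qed
  also have "\<dots> = ennreal (0 - F (y * \<sigma>))"
  proof (rule nn_integral_FTC_atLeast)
    show "f \<in> borel_measurable borel" unfolding f_def[abs_def] by simp
    show "0 \<le> f x" if "y * \<sigma> \<le> x" for x
    proof -
      have "0 < y * \<sigma>" using \<sigma> y by simp
      with that have "0 \<le> x" by linarith
      then show ?thesis unfolding f_def using \<sigma> y by simp
    qed
    show "DERIV F x :> f x" for x
      unfolding F_def[abs_def] f_def normal_density_def using \<sigma> y
      by (auto intro!: derivative_eq_intros simp: field_simps power2_eq_square)
    show "(F \<longlongrightarrow> 0) at_top"
      unfolding F_def[abs_def] normal_density_def using \<sigma> y by real_asymp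
  qed
  also have "0 - F (y * \<sigma>) = exp (- y\<^sup>2 / 2) / (y * sqrt (2 * pi))"
    unfolding F_def normal_density_def using \<sigma> y
    by (simp add: real_sqrt_mult power_mult_distrib)
  also have "ennreal \<dots> \<le> ennreal (exp (- y\<^sup>2 / 2) / (y * 1))"
  proof -
    have "1 \<le> sqrt (2 * pi)" using pi_gt3 by simp
    then show ?thesis using y by (intro ennreal_leI divide_left_mono mult_left_mono) auto
  qed
  finally have "emeasure M (X -` {y * \<sigma>..} \<inter> space M) \<le> ennreal (exp (- y\<^sup>2 / 2) / y)"
    by simp
  moreover have "X -` {y * \<sigma>..} \<inter> space M = {\<omega> \<in> space M. y * \<sigma> \<le> X \<omega>}"
    by auto
  ultimately show ?thesis
    using y by (simp add: emeasure_eq_measure)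
qed

text \<open>
  The density decreases on the positive half-line. A window rather than a half-line is used in the
  lower bound because the value of the path at an excess then also has a known upper bound.
\<close>

lemma normal_interval_ge:
  assumes X: "distributed M lborel X (normal_density 0 \<sigma>)" and \<sigma>: "0 < \<sigma>"
    and u: "0 \<le> u" and w: "0 \<le> w"
  shows "w * normal_density 0 \<sigma> (u + w) \<le> prob {\<omega> \<in> space M. u \<le> X \<omega> \<and> X \<omega> \<le> u + w}"
proof -
  let ?p = "normal_density 0 \<sigma> (u + w)"
  have "ennreal (w * ?p) = (\<integral>\<^sup>+x. ennreal ?p * indicator {u..u + w} x \<partial>lborel)"
    using w by (simp add: nn_integral_cmult_indicator ennreal_mult' mult.commute)
  also have "\<dots> \<le> (\<integral>\<^sup>+x. ennreal (normal_density 0 \<sigma> x) * indicator {u..u + w} x \<partial>lborel)"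
  proof (intro nn_integral_mono)
    fix x :: real
    have "?p \<le> normal_density 0 \<sigma> x" if "u \<le> x" "x \<le> u + w"
    proof -
      have "x\<^sup>2 \<le> (u + w)\<^sup>2" using that u by (intro power_mono) auto
      then show ?thesis
        unfolding normal_density_def using \<sigma> by (auto intro!: divide_right_mono)
    qed
    then show "ennreal ?p * indicator {u..u + w} x
        \<le> ennreal (normal_density 0 \<sigma> x) * indicator {u..u + w} x"
      by (auto simp: indicator_def intro!: ennreal_leI)
  qed
  also have "\<dots> = emeasure M (X -` {u..u + w} \<inter> space M)"
    by (rule distributed_emeasure[OF X, symmetric]) simp
  also have "X -` {u..u + w} \<inter> space M = {\<omega> \<in> space M. u \<le> X \<omega> \<and> X \<omega> \<le> u + w}"
    by auto
  finally show ?thesis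
    by (simp add: emeasure_eq_measure)
qed

lemma normal_nonneg_ge_half:
  assumes X: "distributed M lborel X (normal_density 0 \<sigma>)" and \<sigma>: "0 < \<sigma>"
  shows "1 / 2 \<le> prob {\<omega> \<in> space M. 0 \<le> X \<omega>}"
proof -
  have [measurable]: "X \<in> borel_measurable M"
    using X by (simp add: distributed_def)
  have Y: "distributed M lborel (\<lambda>\<omega>. - X \<omega>) (normal_density 0 \<sigma>)"
    using normal_density_affine[OF X \<sigma>, of "-1" 0] by simp
  have "emeasure M (X -` {0..} \<inter> space M) = emeasure M ((\<lambda>\<omega>. - X \<omega>) -` {0..} \<inter> space M)"
    by (subst distributed_emeasure[OF X], simp, subst distributed_emeasure[OF Y], simp_all)
  moreover have "X -` {0..} \<inter> space M = {\<omega> \<in> space M. 0 \<le> X \<omega>}"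
    "(\<lambda>\<omega>. - X \<omega>) -` {0..} \<inter> space M = {\<omega> \<in> space M. X \<omega> \<le> 0}"
    by auto
  ultimately have eq: "prob {\<omega> \<in> space M. 0 \<le> X \<omega>} = prob {\<omega> \<in> space M. X \<omega> \<le> 0}"
    by (simp add: measure_def)
  have "1 = prob ({\<omega> \<in> space M. 0 \<le> X \<omega>} \<union> {\<omega> \<in> space M. X \<omega> \<le> 0})"
    by (subst prob_space[symmetric], rule arg_cong[where f = prob], auto)
  also have "\<dots> \<le> prob {\<omega> \<in> space M. 0 \<le> X \<omega>} + prob {\<omega> \<in> space M. X \<omega> \<le> 0}"
    by (rule measure_Un_le) auto
  finally show ?thesis using eq by simp
qed

end

section \<open>Independent increments and the reflection principle\<close>

context standard_brownian_motion begin

lemma increment_measurable [measurable]: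
  "0 \<le> s \<Longrightarrow> 0 \<le> t \<Longrightarrow> (\<lambda>\<omega>. B t \<omega> - B s \<omega>) \<in> borel_measurable M"
  using measurable_BM by simp

text \<open>
  The Markov property in the only form used below: an event decided by the increments up to
  \<open>\<tau> k\<close> is independent of the next increment.
\<close>

lemma prob_past_and_increment:
  fixes \<tau> :: "nat \<Rightarrow> real"
  assumes \<tau>0: "0 \<le> \<tau> 0" and \<tau>: "\<And>i. i < k \<Longrightarrow> \<tau> i < \<tau> (Suc i)" and t: "\<tau> k < t"
    and P: "{f \<in> space (PiM {..<k} (\<lambda>_. borel)). P f} \<in> sets (PiM {..<k} (\<lambda>_. borel))"
    and A: "A \<in> sets borel"
  shows "prob {\<omega> \<in> space M. P (\<lambda>i\<in>{..<k}. B (\<tau> (Suc i)) \<omega> - B (\<tau> i) \<omega>)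
            \<and> B t \<omega> - B (\<tau> k) \<omega> \<in> A}
       = prob {\<omega> \<in> space M. P (\<lambda>i\<in>{..<k}. B (\<tau> (Suc i)) \<omega> - B (\<tau> i) \<omega>)}
         * prob {\<omega> \<in> space M. B t \<omega> - B (\<tau> k) \<omega> \<in> A}"
proof -
  define \<tau>' where "\<tau>' i = (if i = Suc k then t else \<tau> i)" for i
  define X where "X i \<omega> = B (\<tau>' (Suc i)) \<omega> - B (\<tau>' i) \<omega>" for i \<omega>
  have ind: "indep_vars (\<lambda>_. borel) X {..<Suc k}"
    unfolding X_def[abs_def]
    by (rule indep_increments) (use \<tau>0 \<tau> t in \<open>auto simp: \<tau>'_def less_Suc_eq\<close>)
  have X: "indep_var (PiM {..<k} (\<lambda>_. borel)) (\<lambda>\<omega>. restrict (\<lambda>i. X i \<omega>) {..<k})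
      (PiM {k} (\<lambda>_. borel)) (\<lambda>\<omega>. restrict (\<lambda>i. X i \<omega>) {k})"
    by (rule indep_var_restrict[OF ind]) auto
  have X1: "restrict (\<lambda>i. X i \<omega>) {..<k} = (\<lambda>i\<in>{..<k}. B (\<tau> (Suc i)) \<omega> - B (\<tau> i) \<omega>)" for \<omega>
    by (auto simp: X_def \<tau>'_def)
  have X2: "X k \<omega> = B t \<omega> - B (\<tau> k) \<omega>" for \<omega>
    by (simp add: X_def \<tau>'_def)
  have A': "{f \<in> space (PiM {k} (\<lambda>_. borel)). f k \<in> A} \<in> sets (PiM {k} (\<lambda>_. borel))"
    using A by measurable
  show ?thesis
    using indep_varD[OF X P A']
    by (simp add: X1 X2 vimage_def Int_def space_PiM PiE_def conj_commute cong: conj_cong)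
qed

text \<open>
  Split the event according to the first index \<open>k\<close> at which the level \<open>x\<close> is reached. Given what
  happened up to \<open>\<tau> k\<close>, the remaining increment is nonnegative with probability at least one half,
  and then the path is still above \<open>x\<close> at the end.
\<close>

lemma prob_grid_max_le:
  fixes \<tau> :: "nat \<Rightarrow> real"
  assumes \<tau>0: "0 \<le> \<tau> 0" and \<tau>: "\<And>i. i < n \<Longrightarrow> \<tau> i < \<tau> (Suc i)" and x: "0 < x"
  shows "prob {\<omega> \<in> space M. \<exists>k\<le>n. x \<le> B (\<tau> k) \<omega> - B (\<tau> 0) \<omega>}
       \<le> 2 * prob {\<omega> \<in> space M. x \<le> B (\<tau> n) \<omega> - B (\<tau> 0) \<omega>}"
proof -
  have mono: "\<tau> i \<le> \<tau> j" if "i \<le> j" "j \<le> n" for i j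
    using that(1) that(2)
  proof (induction j rule: dec_induct)
    case (step m)
    then have "\<tau> i \<le> \<tau> m" "\<tau> m < \<tau> (Suc m)" using \<tau> by auto
    then show ?case by linarith
  qed simp
  have smono: "\<tau> i < \<tau> n" if "i < n" for i
    using \<tau>[OF that] mono[of "Suc i" n] that by simp
  have nonneg: "0 \<le> \<tau> i" if "i \<le> n" for i
    using mono[of 0 i] that \<tau>0 by simp
  define D where "D k \<omega> = B (\<tau> k) \<omega> - B (\<tau> 0) \<omega>" for k \<omega>
  have [measurable]: "D k \<in> borel_measurable M" if "k \<le> n" for k
    unfolding D_def[abs_def] by (rule increment_measurable) (use nonneg that \<tau>0 in auto)
  have Bm [measurable]: "B (\<tau> k) \<in> borel_measurable M" if "k \<le> n" for k
    using nonneg that measurable_BM by simp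
  define F where "F k = {\<omega> \<in> space M. (\<forall>i<k. D i \<omega> < x) \<and> x \<le> D k \<omega>}" for k
  define G where "G = {\<omega> \<in> space M. x \<le> D n \<omega>}"
  have F_meas: "F k \<in> events" if "k \<le> n" for k
  proof -
    have "F k = (\<Inter>i\<in>{..<k}. {\<omega> \<in> space M. D i \<omega> < x}) \<inter> {\<omega> \<in> space M. x \<le> D k \<omega>}"
      if "k \<noteq> 0" using that by (auto simp: F_def)
    moreover have "F 0 = {\<omega> \<in> space M. x \<le> D 0 \<omega>}" by (simp add: F_def)
    ultimately show ?thesis
      using that by (cases "k = 0") (auto intro!: sets.Int sets.finite_INT)
  qed
  have G_meas: "G \<in> events" unfolding G_def by measurable
  have disj: "disjoint_family_on F {..n}"
    unfolding disjoint_family_on_def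
  proof (intro ballI impI)
    fix i j :: nat assume "i \<noteq> j"
    then consider "i < j" | "j < i" by linarith
    then show "F i \<inter> F j = {}" by cases (force simp: F_def)+
  qed
  have half: "prob (F k) \<le> 2 * prob (F k \<inter> G)" if k: "k \<le> n" for k
  proof (cases "k = n")
    case True
    then have "F k \<inter> G = F k" by (auto simp: F_def G_def)
    then show ?thesis by simp
  next
    case False
    then have kn: "k < n" using k by simp
    define P where "P f \<longleftrightarrow> (\<forall>i<k. (\<Sum>l<i. f l) < x) \<and> x \<le> (\<Sum>l<k. f l)" for f :: "nat \<Rightarrow> real"
    have tel: "(\<Sum>l<i. (\<lambda>i\<in>{..<k}. B (\<tau> (Suc i)) \<omega> - B (\<tau> i) \<omega>) l) = D i \<omega>" if "i \<le> k" for i \<omega>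
    proof -
      have "(\<Sum>l<i. (\<lambda>i\<in>{..<k}. B (\<tau> (Suc i)) \<omega> - B (\<tau> i) \<omega>) l)
          = (\<Sum>l<i. B (\<tau> (Suc l)) \<omega> - B (\<tau> l) \<omega>)"
        using that by (intro sum.cong) auto
      also have "\<dots> = D i \<omega>"
        using sum_lessThan_telescope[of "\<lambda>l. B (\<tau> l) \<omega>" i] by (simp add: D_def)
      finally show ?thesis .
    qed
    have PF: "P (\<lambda>i\<in>{..<k}. B (\<tau> (Suc i)) \<omega> - B (\<tau> i) \<omega>)
        \<longleftrightarrow> (\<forall>i<k. D i \<omega> < x) \<and> x \<le> D k \<omega>" for \<omega>
      unfolding P_def using tel by auto
    have "(\<lambda>f. \<Sum>l<i. f l) \<in> borel_measurable (PiM {..<k} (\<lambda>_. borel :: real measure))"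
      if "i \<le> k" for i
      using that by (intro borel_measurable_sum measurable_component_singleton) auto
    note [measurable] = this
    have Pm: "{f \<in> space (PiM {..<k} (\<lambda>_. borel :: real measure)). P f}
        \<in> sets (PiM {..<k} (\<lambda>_. borel))"
      unfolding P_def by measurable
    have "prob (F k) * (1 / 2)
        \<le> prob (F k) * prob {\<omega> \<in> space M. B (\<tau> n) \<omega> - B (\<tau> k) \<omega> \<in> {0..}}"
    proof (intro mult_left_mono)
      have "0 < sqrt (\<tau> n - \<tau> k)" using smono[OF kn] by simp
      with normal_nonneg_ge_half[OF normal_increments[of "\<tau> k" "\<tau> n"]] nonneg[OF k] smono[OF kn]
      show "1 / 2 \<le> prob {\<omega> \<in> space M. B (\<tau> n) \<omega> - B (\<tau> k) \<omega> \<in> {0..}}"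
        by simp
    qed simp
    also have "\<dots> = prob {\<omega> \<in> space M. ((\<forall>i<k. D i \<omega> < x) \<and> x \<le> D k \<omega>)
        \<and> B (\<tau> n) \<omega> - B (\<tau> k) \<omega> \<in> {0..}}"
    proof -
      have "\<tau> i < \<tau> (Suc i)" if "i < k" for i using \<tau> that kn by simp
      from prob_past_and_increment[of \<tau> k "\<tau> n" P "{0..}", OF \<tau>0 this smono[OF kn] Pm]
      show ?thesis unfolding PF F_def by simp
    qed
    also have "\<dots> \<le> prob (F k \<inter> G)"
    proof (rule finite_measure_mono)
      show "F k \<inter> G \<in> events" using F_meas[OF k] G_meas by simp
    qed (auto simp: F_def G_def D_def)
    finally show ?thesis by simp
  qed
  have "{\<omega> \<in> space M. \<exists>k\<le>n. x \<le> D k \<omega>} = (\<Union>k\<in>{..n}. F k)"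
  proof (intro equalityI subsetI)
    fix \<omega> assume "\<omega> \<in> {\<omega> \<in> space M. \<exists>k\<le>n. x \<le> D k \<omega>}"
    then obtain k where k: "k \<le> n" "x \<le> D k \<omega>" and sp: "\<omega> \<in> space M" by auto
    define m where "m = (LEAST k. x \<le> D k \<omega>)"
    have "x \<le> D m \<omega>" "m \<le> k" "\<forall>i<m. \<not> x \<le> D i \<omega>"
      unfolding m_def using k by (auto intro: LeastI Least_le dest: not_less_Least)
    then show "\<omega> \<in> (\<Union>k\<in>{..n}. F k)" using k sp by (auto simp: F_def not_le intro!: bexI[of _ m])
  qed (auto simp: F_def)
  then have "prob {\<omega> \<in> space M. \<exists>k\<le>n. x \<le> D k \<omega>} = (\<Sum>k\<le>n. prob (F k))"
    using disj F_meas by (simp add: finite_measure_finite_Union image_subset_iff)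
  also have "\<dots> \<le> (\<Sum>k\<le>n. 2 * prob (F k \<inter> G))"
    by (intro sum_mono half) simp
  also have "\<dots> = 2 * prob (\<Union>k\<in>{..n}. F k \<inter> G)"
  proof -
    have "disjoint_family_on (\<lambda>k. F k \<inter> G) {..n}"
      using disj by (auto simp: disjoint_family_on_def)
    then show ?thesis
      using F_meas G_meas
      by (subst finite_measure_finite_Union) (auto simp: sum_distrib_left)
  qed
  also have "\<dots> \<le> 2 * prob G"
    using G_meas by (intro mult_left_mono finite_measure_mono) auto
  finally show ?thesis by (simp add: D_def G_def)
qed

text \<open>
  Dyadic grids exhaust the interval, and a continuous path that exceeds \<open>x\<close> somewhere does so on a
  fine enough grid. The supremum is controlled through a measurable event \<open>F\<close> that contains the
  exceedance up to a null set, since the paths are continuous only almost surely and the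
  exceedance itself need not be measurable.
\<close>

lemma reflection_bound:
  assumes T: "0 < T" and x: "0 < x"
  obtains F where "F \<in> events" "prob F \<le> 2 * prob {\<omega> \<in> space M. x \<le> B T \<omega> - B 0 \<omega>}"
    "AE \<omega> in M. (\<exists>s\<in>{0..T}. x < B s \<omega>) \<longrightarrow> \<omega> \<in> F"
proof -
  define \<tau> where "\<tau> n k = T * real k / 2 ^ n" for n k
  define F where "F n = {\<omega> \<in> space M. \<exists>k\<le>2 ^ n. x \<le> B (\<tau> n k) \<omega> - B (\<tau> n 0) \<omega>}" for n
  have \<tau>_pos: "0 \<le> \<tau> n k" for n k using T by (simp add: \<tau>_def)
  have [measurable]: "B (\<tau> n k) \<in> borel_measurable M" for n k
    using \<tau>_pos measurable_BM by simp
  have F_meas: "F n \<in> events" for n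
    unfolding F_def by measurable
  have F_le: "prob (F n) \<le> 2 * prob {\<omega> \<in> space M. x \<le> B T \<omega> - B 0 \<omega>}" for n
    using prob_grid_max_le[of "\<tau> n" "2 ^ n" x] T x
    by (simp add: F_def \<tau>_def divide_strict_right_mono)
  have "incseq F"
  proof (rule incseq_SucI, rule subsetI)
    fix n \<omega> assume "\<omega> \<in> F n"
    then obtain k where "\<omega> \<in> space M" "k \<le> 2 ^ n" "x \<le> B (\<tau> n k) \<omega> - B (\<tau> n 0) \<omega>"
      by (auto simp: F_def)
    moreover have "\<tau> (Suc n) (2 * k) = \<tau> n k" for k by (simp add: \<tau>_def)
    moreover have "\<tau> (Suc n) 0 = \<tau> n 0" by (simp add: \<tau>_def)
    ultimately show "\<omega> \<in> F (Suc n)" by (auto simp: F_def intro!: exI[of _ "2 * k"])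
  qed
  then have "(\<lambda>n. prob (F n)) \<longlonglongrightarrow> prob (\<Union>n. F n)"
    using F_meas by (intro finite_Lim_measure_incseq) auto
  then have "prob (\<Union>n. F n) \<le> 2 * prob {\<omega> \<in> space M. x \<le> B T \<omega> - B 0 \<omega>}"
    using F_le by (intro LIMSEQ_le_const2) auto
  moreover have "(\<Union>n. F n) \<in> events" using F_meas by auto
  moreover have "AE \<omega> in M. (\<exists>s\<in>{0..T}. x < B s \<omega>) \<longrightarrow> \<omega> \<in> (\<Union>n. F n)"
    using start_zero continuous_paths AE_space
  proof eventually_elim
    case (elim \<omega>)
    show ?case
    proof
      assume "\<exists>s\<in>{0..T}. x < B s \<omega>"
      then obtain s where s: "0 \<le> s" "s \<le> T" "x < B s \<omega>" by auto
      \<comment> \<open>The last dyadic point of level \<open>n\<close> that is not after \<open>s\<close>.\<close>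
      define k where "k n = nat \<lfloor>2 ^ n * s / T\<rfloor>" for n
      have k1: "k n \<le> 2 ^ n" for n
      proof -
        have "2 ^ n * s / T \<le> 2 ^ n" using s T by (simp add: field_simps)
        then have "\<lfloor>2 ^ n * s / T\<rfloor> \<le> 2 ^ n" by (simp add: floor_le_iff)
        then show ?thesis by (simp add: k_def nat_le_iff)
      qed
      have up: "\<tau> n (k n) \<le> s" and lo: "s - T * (1 / 2) ^ n \<le> \<tau> n (k n)" for n
      proof -
        have "real (k n) = of_int \<lfloor>2 ^ n * s / T\<rfloor>"
          using s T by (simp add: k_def)
        then have "real (k n) \<le> 2 ^ n * s / T" "2 ^ n * s / T < real (k n) + 1"
          by linarith+
        then show "\<tau> n (k n) \<le> s" "s - T * (1 / 2) ^ n \<le> \<tau> n (k n)"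
          using T by (simp_all add: \<tau>_def power_one_over divide_simps) (auto simp: algebra_simps)
      qed
      have "(\<lambda>n. s - T * (1 / 2) ^ n) \<longlonglongrightarrow> s - T * 0"
        by (intro tendsto_intros LIMSEQ_power_zero) auto
      then have "(\<lambda>n. s - T * (1 / 2) ^ n) \<longlonglongrightarrow> s"
        by simp
      from tendsto_sandwich[OF _ _ this tendsto_const]
      have "(\<lambda>n. \<tau> n (k n)) \<longlonglongrightarrow> s"
        using up lo by (meson always_eventually)
      then have "(\<lambda>n. B (\<tau> n (k n)) \<omega>) \<longlonglongrightarrow> B s \<omega>"
        by (rule continuous_on_tendsto_compose[OF elim(2)]) (use s \<tau>_pos in simp_all)
      from order_tendstoD(1)[OF this s(3)] obtain n where "x < B (\<tau> n (k n)) \<omega>"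
        by (auto simp: eventually_sequentially)
      moreover have "B (\<tau> n 0) \<omega> = 0" using elim(1) by (simp add: \<tau>_def)
      ultimately have "\<omega> \<in> F n" using k1 elim(3) by (auto simp: F_def intro!: exI[of _ "k n"])
      then show "\<omega> \<in> (\<Union>n. F n)" by blast
    qed
  qed
  ultimately show ?thesis using that by blast
qed

lemma sup_tail_le:
  assumes T: "0 < T" and y: "0 < y"
  obtains F where "F \<in> events" "prob F \<le> 2 * exp (- y\<^sup>2 / 2) / y"
    "AE \<omega> in M. (\<exists>s\<in>{0..T}. y * sqrt T < B s \<omega>) \<longrightarrow> \<omega> \<in> F"
proof -
  have "prob {\<omega> \<in> space M. y * sqrt T \<le> B T \<omega> - B 0 \<omega>} \<le> exp (- y\<^sup>2 / 2) / y"
    using normal_tail_le[OF normal_increments[of 0 T]] T y by simp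
  then have le: "2 * prob {\<omega> \<in> space M. y * sqrt T \<le> B T \<omega> - B 0 \<omega>} \<le> 2 * exp (- y\<^sup>2 / 2) / y"
    by simp
  have "0 < y * sqrt T" using T y by simp
  from reflection_bound[OF T this] obtain F where "F \<in> events"
    "prob F \<le> 2 * prob {\<omega> \<in> space M. y * sqrt T \<le> B T \<omega> - B 0 \<omega>}"
    "AE \<omega> in M. (\<exists>s\<in>{0..T}. y * sqrt T < B s \<omega>) \<longrightarrow> \<omega> \<in> F" .
  with le that show ?thesis by fastforce
qed

end

section \<open>The upper bound along blocks of scales\<close>

lemma sqrt_exp: "sqrt (exp x) = exp (x / 2)" for x :: real
  by (simp add: real_sqrt_unique power2_eq_square flip: exp_add)

text \<open>
  The first factor bounds the number of mesh intervals at level \<open>m\<close>; the second one is twice the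
  Gaussian tail bound at the level \<open>y\<close> of \<open>AE_eventually_blockwise_upper\<close>. Since \<open>y\<^sup>2 / 2 = m + 2 * c * ln m + O(1)\<close>, the
  powers of \<open>exp m\<close> cancel.
\<close>

lemma upper_union_bound_bigo:
  fixes c :: real
  assumes "0 < c"
  shows "(\<lambda>m::nat. (real m * exp (real m + 1) + 1) *
      (2 * exp (- (exp (- 1 / real m) * real m * (1 + c * ln (real m) / real m)\<^sup>2))
        / (exp (- 1 / (2 * real m)) * sqrt (2 * real m) * (1 + c * ln (real m) / real m))))
    \<in> O(\<lambda>m. real m powr (1 / 2 - 2 * c))"
  using assms by real_asymp

context standard_brownian_motion begin

text \<open>
  The times with \<open>m \<le> ln (ln s) \<le> m + 1\<close> are covered by the intervals
  \<open>[exp (u m i), exp (u m (i + 1))]\<close>, on which \<open>ln s\<close> grows by \<open>1 / m\<close>. This is the coarsest mesh for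
  which replacing the left end by the right end changes the exponent \<open>y\<^sup>2 / 2\<close>
  of the Gaussian tail by a bounded amount only. There are about \<open>m * exp (m + 1)\<close> intervals, and the
  total probability is of order \<open>m powr (1/2 - 2 * c)\<close>, which is summable exactly for \<open>c > 3/4\<close>.
\<close>

lemma AE_eventually_blockwise_upper:
  fixes c :: real
  assumes c: "3 / 4 < c"
  shows "AE \<omega> in M. eventually (\<lambda>m. \<forall>s. exp 1 < s \<longrightarrow> real m \<le> ln (ln s) \<longrightarrow> ln (ln s) \<le> real m + 1
      \<longrightarrow> B s \<omega> \<le> sqrt s * sqrt (2 * real m) * (1 + c * ln (real m) / real m)) sequentially"
proof -
  define u where "u m i = exp (real m) + real i / real m" for m i :: nat
  define g where "g m = 1 + c * ln (real m) / real m" for m :: nat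
  define y where "y m = exp (- 1 / (2 * real m)) * sqrt (2 * real m) * g m" for m :: nat
  define p where "p m = 2 * exp (- (exp (- 1 / real m) * real m * (g m)\<^sup>2)) / y m" for m
  have p_eq: "2 * exp (- (y m)\<^sup>2 / 2) / y m = p m" for m
    by (simp add: p_def y_def power_mult_distrib flip: exp_double)
  have g_ge: "1 \<le> g m" if "1 \<le> m" for m
    using that c by (simp add: g_def)
  have y_pos: "0 < y m" if "1 \<le> m" for m
    using g_ge[OF that] that by (simp add: y_def)
  define Q where "Q m i F \<longleftrightarrow> F \<in> events \<and> prob F \<le> p m \<and>
      (AE \<omega> in M. (\<exists>s\<in>{0..exp (u m (Suc i))}. y m * sqrt (exp (u m (Suc i))) < B s \<omega>) \<longrightarrow> \<omega> \<in> F)"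
    for m i F
  have "\<exists>F. Q m i F" if "1 \<le> m" for m i
    unfolding Q_def p_eq[symmetric]
    by (rule sup_tail_le[of "exp (u m (Suc i))" "y m"]) (use y_pos[OF that] in auto)
  then obtain F where "\<And>m i. 1 \<le> m \<Longrightarrow> Q m i (F m i)"
    by metis
  then have F: "\<And>m i. 1 \<le> m \<Longrightarrow> F m i \<in> events"
      "\<And>m i. 1 \<le> m \<Longrightarrow> prob (F m i) \<le> p m"
      "\<And>m i. 1 \<le> m \<Longrightarrow> AE \<omega> in M.
        (\<exists>s\<in>{0..exp (u m (Suc i))}. y m * sqrt (exp (u m (Suc i))) < B s \<omega>) \<longrightarrow> \<omega> \<in> F m i"
    unfolding Q_def by blast+
  define K where "K m = nat \<lfloor>real m * exp (real m + 1)\<rfloor>" for m :: nat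
  define A where "A m = (if m = 0 then {} else \<Union>i\<in>{..K m}. F m i)" for m
  have A_meas: "A m \<in> events" for m
    using F(1) by (auto simp: A_def)
  have A_le: "prob (A m) \<le> (real m * exp (real m + 1) + 1) * p m" if m: "1 \<le> m" for m
  proof -
    have p_pos: "0 \<le> p m" using y_pos[OF m] by (simp add: p_def)
    have "prob (A m) \<le> (\<Sum>i\<in>{..K m}. prob (F m i))"
      using m F(1)[OF m] by (auto simp: A_def intro!: finite_measure_subadditive_finite)
    also have "\<dots> \<le> (\<Sum>i\<in>{..K m}. p m)"
      by (intro sum_mono F m)
    also have "\<dots> = (real (K m) + 1) * p m" by simp
    also have "\<dots> \<le> (real m * exp (real m + 1) + 1) * p m"
      using p_pos by (intro mult_right_mono) (auto simp: K_def)
    finally show ?thesis .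
  qed
  have "summable (\<lambda>m. (real m * exp (real m + 1) + 1) * p m)"
  proof (rule summable_comparison_test_bigo)
    show "summable (\<lambda>m. norm (real m powr (1 / 2 - 2 * c)))"
      using c by (simp add: summable_real_powr_iff)
    show "(\<lambda>m. (real m * exp (real m + 1) + 1) * p m) \<in> O(\<lambda>m. real m powr (1 / 2 - 2 * c))"
      unfolding p_def y_def g_def using c by (intro upper_union_bound_bigo) simp
  qed
  then have "summable (\<lambda>m. prob (A m))"
    by (rule summable_comparison_test_ev[rotated])
       (use A_le in \<open>auto simp: eventually_sequentially\<close>)
  then have "AE \<omega> in M. eventually (\<lambda>m. \<omega> \<in> space M - A m) sequentially"
    using A_meas by (intro borel_cantelli_AE1) (auto simp: emeasure_eq_measure)
  moreover have "AE \<omega> in M. \<forall>m\<ge>1. \<forall>i.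
        (\<exists>s\<in>{0..exp (u m (Suc i))}. y m * sqrt (exp (u m (Suc i))) < B s \<omega>) \<longrightarrow> \<omega> \<in> F m i"
    using F(3) by (auto simp: AE_all_countable intro: AE_impI)
  ultimately show ?thesis
  proof eventually_elim
    case (elim \<omega>)
    have ev: "eventually (\<lambda>m. \<omega> \<in> space M - A m \<and> 1 \<le> m) sequentially"
      using elim(1) eventually_ge_at_top by (rule eventually_conj)
    from ev show ?case
    proof eventually_elim
      fix m assume *: "\<omega> \<in> space M - A m \<and> 1 \<le> m"
      then have m: "1 \<le> m" by simp
      show "\<forall>s. exp 1 < s \<longrightarrow> real m \<le> ln (ln s) \<longrightarrow> ln (ln s) \<le> real m + 1
      \<longrightarrow> B s \<omega> \<le> sqrt s * sqrt (2 * real m) * (1 + c * ln (real m) / real m)"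
      proof (intro allI impI, rule ccontr)
        fix s :: real
        assume s: "exp 1 < s" and s1: "real m \<le> ln (ln s)" and s2: "ln (ln s) \<le> real m + 1"
          and "\<not> B s \<omega> \<le> sqrt s * sqrt (2 * real m) * (1 + c * ln (real m) / real m)"
        then have Bs: "sqrt s * sqrt (2 * real m) * g m < B s \<omega>" by (simp add: g_def)
        have s0: "0 < s" using s exp_gt_zero[of "1::real"] by linarith
        have l1: "1 < ln s" using s s0 by (metis exp_less_cancel_iff exp_ln)
        have v1: "exp (real m) \<le> ln s" and v2: "ln s \<le> exp (real m + 1)"
          using s1 s2 l1 by (metis exp_le_cancel_iff exp_ln less_trans zero_less_one)+
        define i where "i = nat \<lfloor>(ln s - exp (real m)) * real m\<rfloor>"
        have "0 \<le> (ln s - exp (real m)) * real m" using v1 by simp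
        then have i1: "real i \<le> (ln s - exp (real m)) * real m" 
          and i2: "(ln s - exp (real m)) * real m < real i + 1"
          unfolding i_def by linarith+
        have "(ln s - exp (real m)) * real m \<le> exp (real m + 1) * real m"
          using v2 by (intro mult_right_mono) (simp_all add: add_increasing2 diff_le_eq)
        then have "i \<le> K m"
          unfolding i_def K_def by (intro nat_mono floor_mono) (simp add: mult.commute)
        have ui: "u m i \<le> ln s" "ln s < u m (Suc i)"
          using i1 i2 m by (simp_all add: u_def field_simps)
        have "s = exp (ln s)" using s0 by simp
        then have es: "exp (u m i) \<le> s" "s \<le> exp (u m (Suc i))"
          using ui by (metis exp_le_cancel_iff, metis exp_le_cancel_iff less_imp_le)
        have "y m * sqrt (exp (u m (Suc i))) = sqrt (exp (u m i)) * sqrt (2 * real m) * g m"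
        proof -
          have "u m (Suc i) = u m i + 1 / real m" using m by (simp add: u_def field_simps)
          \<comment> \<open>This ratio of standard deviations is the reason for the first factor of \<open>y m\<close>.\<close>
          then have "exp (- 1 / (2 * real m)) * sqrt (exp (u m (Suc i))) = sqrt (exp (u m i))"
            by (simp add: sqrt_exp add_divide_distrib flip: exp_add)
          then show ?thesis by (simp add: y_def)
        qed
        also have "\<dots> \<le> sqrt s * sqrt (2 * real m) * g m"
          using es g_ge[OF m] by (intro mult_right_mono) auto
        also note Bs
        finally have "\<omega> \<in> F m i"
          using elim(2) m es s0 by fastforce
        then have "\<omega> \<in> A m" using \<open>i \<le> K m\<close> m by (auto simp: A_def)
        with * show False by simp
      qed
    qed
  qed
qed

end

section \<open>Excesses in independent blocks of time\<close>

context prob_space begin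

text \<open>
  Keep from \<open>A i\<close> only the outcomes for which \<open>i\<close> is the last index that occurs. These parts are
  disjoint, and each of them has lost at most half of \<open>prob (A i)\<close>.
\<close>

lemma prob_Union_ge_half_sum:
  fixes A :: "nat \<Rightarrow> 'a set"
  assumes I: "finite I" and A: "\<And>i. i \<in> I \<Longrightarrow> A i \<in> events"
    and pairs: "\<And>i. i \<in> I \<Longrightarrow> (\<Sum>j\<in>{j\<in>I. i < j}. prob (A i \<inter> A j)) \<le> prob (A i) / 2"
  shows "(\<Sum>i\<in>I. prob (A i)) / 2 \<le> prob (\<Union>i\<in>I. A i)"
proof -
  define D where "D i = A i - (\<Union>j\<in>{j\<in>I. i < j}. A j)" for i
  have D: "D i \<in> events" if "i \<in> I" for i
    using that A I unfolding D_def by (intro sets.Diff sets.finite_UN) auto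
  have "prob (A i) / 2 \<le> prob (D i)" if i: "i \<in> I" for i
  proof -
    have "prob (A i) = prob (D i \<union> (\<Union>j\<in>{j\<in>I. i < j}. A i \<inter> A j))"
      by (rule arg_cong[where f = prob]) (auto simp: D_def)
    also have "\<dots> \<le> prob (D i) + prob (\<Union>j\<in>{j\<in>I. i < j}. A i \<inter> A j)"
      using D[OF i] A I i by (intro measure_Un_le sets.finite_UN) auto
    also have "prob (\<Union>j\<in>{j\<in>I. i < j}. A i \<inter> A j) \<le> (\<Sum>j\<in>{j\<in>I. i < j}. prob (A i \<inter> A j))"
      using A I i by (intro finite_measure_subadditive_finite) auto
    also have "\<dots> \<le> prob (A i) / 2" by (rule pairs[OF i])
    finally show ?thesis by simp
  qed
  then have "(\<Sum>i\<in>I. prob (A i)) / 2 \<le> (\<Sum>i\<in>I. prob (D i))"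
    by (simp add: sum_divide_distrib sum_mono)
  also have "\<dots> = prob (\<Union>i\<in>I. D i)"
  proof (rule finite_measure_finite_Union[symmetric])
    show "disjoint_family_on D I"
      unfolding disjoint_family_on_def
    proof (intro ballI impI)
      fix i j assume "i \<in> I" "j \<in> I" "i \<noteq> j"
      then show "D i \<inter> D j = {}" by (cases i j rule: linorder_cases) (auto simp: D_def)
    qed
  qed (use I D in auto)
  also have "\<dots> \<le> prob (\<Union>i\<in>I. A i)"
    using A I by (intro finite_measure_mono sets.finite_UN) (auto simp: D_def)
  finally show ?thesis .
qed

end

context standard_brownian_motion begin

text \<open>
  The event of block \<open>q\<close> is decided by the increments with indices in \<open>{q * L..<Suc q * L}\<close>, and
  these index sets are disjoint.
\<close>

lemma indep_blocks:
  fixes \<tau> :: "nat \<Rightarrow> real" and \<theta> :: "nat \<Rightarrow> nat \<Rightarrow> real"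
  assumes \<tau>0: "0 \<le> \<tau> 0" and \<tau>: "\<And>i. \<tau> i < \<tau> (Suc i)" and N: "N < L" and J: "finite J"
  shows "prob {\<omega> \<in> space M. \<forall>q\<in>J. \<forall>i\<in>{1..N}. B (\<tau> (q * L + i)) \<omega> - B (\<tau> (q * L)) \<omega> < \<theta> q i}
    = (\<Prod>q\<in>J. prob {\<omega> \<in> space M. \<forall>i\<in>{1..N}. B (\<tau> (q * L + i)) \<omega> - B (\<tau> (q * L)) \<omega> < \<theta> q i})"
proof (cases "J = {}")
  case True
  then show ?thesis by (simp add: prob_space)
next
  case False
  define n where "n = Suc (Max J) * L"
  define X where "X i \<omega> = B (\<tau> (Suc i)) \<omega> - B (\<tau> i) \<omega>" for i \<omega>
  define K where "K q = {q * L..<Suc q * L}" for q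
  define A where "A q = {f \<in> space (PiM (K q) (\<lambda>_. borel :: real measure)).
      \<forall>i\<in>{1..N}. (\<Sum>l<i. f (q * L + l)) < \<theta> q i}" for q
  have ind: "indep_vars (\<lambda>_. borel) X {..<n}"
    unfolding X_def[abs_def] by (rule indep_increments) (use \<tau>0 \<tau> in auto)
  have indK: "indep_vars (\<lambda>q. PiM (K q) (\<lambda>_. borel)) (\<lambda>q \<omega>. restrict (\<lambda>i. X i \<omega>) (K q)) J"
  proof (rule indep_vars_restrict[OF ind])
    fix q assume "q \<in> J"
    then have "Suc q * L \<le> n" using J unfolding n_def by (intro mult_right_mono) auto
    then show "K q \<subseteq> {..<n}" unfolding K_def by auto
  next
    show "disjoint_family_on K J"
      unfolding disjoint_family_on_def
    proof (intro ballI impI)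
      fix p q :: nat assume "p \<noteq> q"
      have *: "x div L = q" if "x \<in> K q" for x q
        using that N by (auto simp: K_def mult.commute[of _ L] intro!: div_nat_eqI)
      then show "K p \<inter> K q = {}" using * \<open>p \<noteq> q\<close> by blast
    qed
  qed
  have A: "A q \<in> sets (PiM (K q) (\<lambda>_. borel))" for q
  proof -
    have [measurable]: "(\<lambda>f. \<Sum>l<i. f (q * L + l)) \<in> borel_measurable (PiM (K q) (\<lambda>_. borel :: real measure))"
      if "i \<in> {1..N}" for i
      using that N
      by (intro borel_measurable_sum measurable_component_singleton) (auto simp: K_def)
    show ?thesis unfolding A_def by measurable
  qed
  have eq: "(\<lambda>\<omega>. restrict (\<lambda>i. X i \<omega>) (K q)) -` A q \<inter> space M
      = {\<omega> \<in> space M. \<forall>i\<in>{1..N}. B (\<tau> (q * L + i)) \<omega> - B (\<tau> (q * L)) \<omega> < \<theta> q i}" for q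
  proof -
    have "(\<Sum>l<i. restrict (\<lambda>i. X i \<omega>) (K q) (q * L + l)) = B (\<tau> (q * L + i)) \<omega> - B (\<tau> (q * L)) \<omega>"
      if "i \<in> {1..N}" for i \<omega>
    proof -
      have "(\<Sum>l<i. restrict (\<lambda>i. X i \<omega>) (K q) (q * L + l)) = (\<Sum>l<i. X (q * L + l) \<omega>)"
        using that N by (intro sum.cong) (auto simp: K_def)
      also have "\<dots> = B (\<tau> (q * L + i)) \<omega> - B (\<tau> (q * L)) \<omega>"
        using sum_lessThan_telescope[of "\<lambda>l. B (\<tau> (q * L + l)) \<omega>" i] by (simp add: X_def)
      finally show ?thesis .
    qed
    then show ?thesis by (auto simp: A_def space_PiM)
  qed
  have "{\<omega> \<in> space M. \<forall>q\<in>J. \<forall>i\<in>{1..N}. B (\<tau> (q * L + i)) \<omega> - B (\<tau> (q * L)) \<omega> < \<theta> q i}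
      = (\<Inter>q\<in>J. (\<lambda>\<omega>. restrict (\<lambda>i. X i \<omega>) (K q)) -` A q \<inter> space M)"
    unfolding eq using False by auto
  then show ?thesis
    using indep_varsD_finite[OF indK False J A] unfolding eq by simp
qed

text \<open>
  In the proof, the event \<open>A i\<close> says that the increment from \<open>T\<close> to \<open>s i\<close> lies in the window of relative height
  \<open>a\<close> and width \<open>1 / a\<close>. The window is as wide as the natural overshoot, so it carries a fixed
  fraction of the tail. If both \<open>A i\<close> and \<open>A j\<close> occur with \<open>i < j\<close>, the path must rise
  between \<open>s i\<close> and \<open>s j\<close> by almost \<open>a * (sqrt (s j) - sqrt (s i))\<close>, because the overshoot at \<open>s i\<close> is
  at most \<open>sqrt (s i) / a\<close>. For points at distance at least \<open>S / (2 * Suc N)\<close> with \<open>Suc N\<close> small compared to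
  \<open>a\<^sup>2\<close> this is a rise of many standard deviations, and it is independent of \<open>A i\<close>. So the events
  are nearly disjoint.
\<close>

lemma block_prob_ge:
  fixes T S a :: real and N :: nat
  defines "s \<equiv> \<lambda>i. S / 2 * (1 + real i / real (Suc N))"
  assumes T: "0 < T" and a: "1 \<le> a" and TS: "T * (a\<^sup>2 + 3) \<le> S / 4"
    and aN: "32 * real (Suc N) \<le> a\<^sup>2"
    and tail: "2 * real N * exp (- a\<^sup>2 / (64 * real (Suc N))) \<le> 1"
  shows "real N * exp (- a\<^sup>2 / 2 - 3) / (2 * a)
      \<le> prob {\<omega> \<in> space M. \<exists>i\<in>{1..N}. a * sqrt (s i) \<le> B (s i) \<omega> - B T \<omega>}"
proof -
  have a0: "0 < a" using a by simp
  have "T * 4 \<le> T * (a\<^sup>2 + 3)"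
    using a T by (intro mult_left_mono) (auto simp: power2_eq_square mult_ge1_I)
  then have T4: "T * 4 \<le> S / 4" using TS by simp
  then have S: "0 < S" and TS2: "T < S / 4" using T by linarith+
  have s_ge: "S / 2 \<le> s i" for i using S by (simp add: s_def)
  have s_le: "s i \<le> S" if "i \<in> {1..N}" for i
  proof -
    have "real i / real (Suc N) \<le> 1" using that by simp
    then have "S / 2 * (1 + real i / real (Suc N)) \<le> S / 2 * (1 + 1)"
      using S by (intro mult_left_mono add_left_mono) auto
    then show ?thesis by (simp add: s_def)
  qed
  have sT: "T < s i" for i using s_ge[of i] TS2 T by linarith
  have s0: "0 < s i" for i using sT[of i] T by linarith
  define A where "A i = {\<omega> \<in> space M. a * sqrt (s i) \<le> B (s i) \<omega> - B T \<omega>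
      \<and> B (s i) \<omega> - B T \<omega> \<le> a * sqrt (s i) + sqrt (s i) / a}" for i
  have incr [measurable]: "(\<lambda>\<omega>. B (s i) \<omega> - B T \<omega>) \<in> borel_measurable M" for i
    using s0[of i] T by (intro increment_measurable) auto
  have A_meas: "A i \<in> events" for i unfolding A_def by measurable
  have A_ge: "exp (- a\<^sup>2 / 2 - 3) / a \<le> prob (A i)" for i
  proof -
    define v where "v = s i - T"
    have v0: "0 < v" and vs: "v < s i" using sT[of i] T by (auto simp: v_def)
    \<comment> \<open>The increment has variance \<open>v = s i - T\<close> instead of \<open>s i\<close>; \<open>T\<close> is so small that this
      adds only a constant to the exponent.\<close>
    have "(a + 1 / a)\<^sup>2 * s i \<le> (a\<^sup>2 + 4) * v"
    proof -
      have "1 / a\<^sup>2 \<le> 1" using a by simp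
      then have "(a + 1 / a)\<^sup>2 \<le> a\<^sup>2 + 3"
        using a0 by (simp add: power2_sum power_divide)
      then have "(a + 1 / a)\<^sup>2 * s i \<le> (a\<^sup>2 + 3) * s i"
        using s0[of i] by (intro mult_right_mono) auto
      also have "\<dots> = (a\<^sup>2 + 3) * v + T * (a\<^sup>2 + 3)" by (simp add: v_def algebra_simps)
      also have "T * (a\<^sup>2 + 3) \<le> v"
        using TS s_ge[of i] TS2 by (simp add: v_def)
      finally show ?thesis by (simp add: algebra_simps)
    qed
    then have expo: "(a * sqrt (s i) + sqrt (s i) / a)\<^sup>2 / (2 * v) \<le> a\<^sup>2 / 2 + 2"
    proof -
      have "(a * sqrt (s i) + sqrt (s i) / a)\<^sup>2 = ((a + 1 / a) * sqrt (s i))\<^sup>2"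
        by (simp add: algebra_simps)
      also have "\<dots> = (a + 1 / a)\<^sup>2 * s i"
        using s0[of i] by (simp add: power_mult_distrib)
      also have "\<dots> \<le> (a\<^sup>2 + 4) * v" by fact
      finally show ?thesis using v0 by (simp add: divide_le_eq algebra_simps)
    qed
    have "sqrt (2 * pi) \<le> exp 1"
    proof (rule real_le_lsqrt)
      have "2 * pi \<le> 2.7\<^sup>2" using pi_less_4 pi_approx by (simp add: power2_eq_square)
      also have "\<dots> \<le> (exp 1)\<^sup>2"
      proof (rule power_mono)
        show "2.7 \<le> exp (1::real)" using e_approx_32 unfolding abs_le_iff by simp
      qed simp
      finally show "2 * pi \<le> (exp 1)\<^sup>2" .
    qed auto
    have "exp (- a\<^sup>2 / 2 - 3) / a = exp (- (a\<^sup>2 / 2 + 2)) / (a * exp 1)"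
      using a0 by (simp add: field_simps flip: exp_add)
    also have "\<dots> \<le> exp (- (a\<^sup>2 / 2 + 2)) / (a * sqrt (2 * pi))"
      using a0 \<open>sqrt (2 * pi) \<le> exp 1\<close> by (intro divide_left_mono mult_left_mono) auto
    also have "\<dots> \<le> exp (- ((a * sqrt (s i) + sqrt (s i) / a)\<^sup>2 / (2 * v))) / (a * sqrt (2 * pi))"
      using expo a0 by (intro divide_right_mono) auto
    also have "\<dots> = (sqrt v / a) * normal_density 0 (sqrt v) (a * sqrt (s i) + sqrt (s i) / a)"
      using v0 a0 by (simp add: normal_density_def real_sqrt_mult)
    also have "\<dots> \<le> (sqrt (s i) / a) * normal_density 0 (sqrt v) (a * sqrt (s i) + sqrt (s i) / a)"
      using vs a0 by (intro mult_right_mono divide_right_mono) auto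
    also have "\<dots> \<le> prob (A i)"
      unfolding A_def
    proof (rule normal_interval_ge)
      show "distributed M lborel (\<lambda>\<omega>. B (s i) \<omega> - B T \<omega>) (normal_density 0 (sqrt v))"
        unfolding v_def using T sT[of i] by (intro normal_increments) auto
    qed (use v0 a0 s0[of i] in auto)
    finally show ?thesis .
  qed
  have pair: "prob (A i \<inter> A j) \<le> prob (A i) * (1 / (2 * real N))"
    if i: "i \<in> {1..N}" and j: "j \<in> {1..N}" and ij: "i < j" for i j
  proof -
    define D where "D = s j - s i"
    \<comment> \<open>Half of the required rise, in standard deviations, for the smallest possible distance
      \<open>S / (2 * Suc N)\<close>; the other half absorbs the overshoot at \<open>s i\<close>.\<close>
    define z where "z = a / (4 * sqrt (2 * real (Suc N)))"
    have D_eq: "D = S / 2 * ((real j - real i) / real (Suc N))"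
      by (simp add: D_def s_def algebra_simps diff_divide_distrib)
    have D_ge: "S / (2 * real (Suc N)) \<le> D"
    proof -
      have "S / 2 * (1 / real (Suc N)) \<le> D"
        unfolding D_eq using ij S by (intro mult_left_mono divide_right_mono) auto
      then show ?thesis by simp
    qed
    then have D0: "0 < D" using S by (smt (verit) divide_pos_pos of_nat_0_less_iff zero_less_Suc)
    then have sij: "s i < s j" by (simp add: D_def)
    have z1: "1 \<le> z"
    proof -
      have "4 * sqrt (2 * real (Suc N)) = sqrt (32 * real (Suc N))"
        using real_sqrt_mult[of 16 "2 * real (Suc N)"] by simp
      also have "\<dots> \<le> sqrt (a\<^sup>2)" using aN by (intro real_sqrt_le_mono)
      finally show ?thesis using a0 by (simp add: z_def)
    qed
    have z2: "z\<^sup>2 / 2 = a\<^sup>2 / (64 * real (Suc N))"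
      by (simp add: z_def power_divide power_mult_distrib)
    have gap: "z * sqrt D \<le> a * sqrt (s j) - (a * sqrt (s i) + sqrt (s i) / a)"
    proof -
      have sS: "sqrt (s i) \<le> sqrt S" "sqrt (s j) \<le> sqrt S" using s_le i j by auto
      have sum0: "0 < sqrt (s j) + sqrt (s i)" using s0[of i] s0[of j] by (simp add: add_pos_pos)
      have "sqrt (s j) + sqrt (s i) \<le> 2 * sqrt S" using sS by linarith
      then have "D / (2 * sqrt S) \<le> D / (sqrt (s j) + sqrt (s i))"
        using D0 sum0 S by (intro divide_left_mono mult_pos_pos) simp_all
      also have "\<dots> = sqrt (s j) - sqrt (s i)"
        using sum0 s0[of i] s0[of j] by (simp add: D_def field_simps)
      finally have "a * (D / (2 * sqrt S)) \<le> a * (sqrt (s j) - sqrt (s i))"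
        using a0 by (intro mult_left_mono) auto
      moreover have "z * sqrt D \<le> a * D / (4 * sqrt S)"
      proof -
        have "sqrt S / sqrt (2 * real (Suc N)) \<le> sqrt D"
          using D_ge by (metis real_sqrt_divide real_sqrt_le_mono)
        then have "sqrt D * (sqrt S / sqrt (2 * real (Suc N))) \<le> sqrt D * sqrt D"
          using D0 by (intro mult_left_mono) auto
        then have "sqrt D / sqrt (2 * real (Suc N)) \<le> D / sqrt S"
          using D0 S by (simp add: field_simps)
        then have "(a / 4) * (sqrt D / sqrt (2 * real (Suc N))) \<le> (a / 4) * (D / sqrt S)"
          using a0 by (intro mult_left_mono) auto
        then show ?thesis by (simp add: z_def)
      qed
      moreover have "sqrt (s i) / a \<le> a * D / (4 * sqrt S)"
      proof -
        have "S * (8 * real (Suc N)) \<le> S * a\<^sup>2"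
          using aN S by (intro mult_left_mono) auto
        then have "4 * S / a\<^sup>2 \<le> S / (2 * real (Suc N))"
          using a0 S by (simp add: divide_simps)
        also note D_ge
        finally have "4 * S \<le> a * a * D" using a0 by (simp add: field_simps power2_eq_square)
        moreover obtain x where "0 < x" "sqrt S = x" "S = x * x"
          using S by (metis real_sqrt_gt_zero real_sqrt_mult_self abs_of_pos)
        ultimately have "sqrt S / a \<le> a * D / (4 * sqrt S)"
          using a0 by (simp add: field_simps)
        moreover have "sqrt (s i) / a \<le> sqrt S / a" using sS a0 by (intro divide_right_mono) auto
        ultimately show ?thesis by linarith
      qed
      ultimately show ?thesis by (simp add: algebra_simps)
    qed
    define \<tau> where "\<tau> k = (if k = 0 then T else s i)" for k :: nat
    define P where "P f \<longleftrightarrow> a * sqrt (s i) \<le> f 0 \<and> f 0 \<le> a * sqrt (s i) + sqrt (s i) / a"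
      for f :: "nat \<Rightarrow> real"
    have "prob (A i \<inter> A j) \<le> prob {\<omega> \<in> space M.
        P (\<lambda>k\<in>{..<1}. B (\<tau> (Suc k)) \<omega> - B (\<tau> k) \<omega>) \<and> B (s j) \<omega> - B (\<tau> 1) \<omega> \<in> {z * sqrt D..}}"
    proof (rule finite_measure_mono)
      show "A i \<inter> A j \<subseteq> {\<omega> \<in> space M.
        P (\<lambda>k\<in>{..<1}. B (\<tau> (Suc k)) \<omega> - B (\<tau> k) \<omega>) \<and> B (s j) \<omega> - B (\<tau> 1) \<omega> \<in> {z * sqrt D..}}"
        using gap by (auto simp: A_def P_def \<tau>_def)
      have [measurable]: "(\<lambda>\<omega>. B (s j) \<omega> - B (s i) \<omega>) \<in> borel_measurable M"
        using s0[of i] s0[of j] by (intro increment_measurable) auto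
      show "{\<omega> \<in> space M.
        P (\<lambda>k\<in>{..<1}. B (\<tau> (Suc k)) \<omega> - B (\<tau> k) \<omega>) \<and> B (s j) \<omega> - B (\<tau> 1) \<omega> \<in> {z * sqrt D..}} \<in> events"
        unfolding P_def by (simp add: \<tau>_def)
    qed
    also have "\<dots> = prob {\<omega> \<in> space M. P (\<lambda>k\<in>{..<1}. B (\<tau> (Suc k)) \<omega> - B (\<tau> k) \<omega>)}
        * prob {\<omega> \<in> space M. B (s j) \<omega> - B (\<tau> 1) \<omega> \<in> {z * sqrt D..}}"
    proof (rule prob_past_and_increment)
      show "{f \<in> space (PiM {..<1} (\<lambda>_. borel)). P f} \<in> sets (PiM {..<1} (\<lambda>_. borel))"
        unfolding P_def by measurable
    qed (use T sT[of i] sij in \<open>auto simp: \<tau>_def\<close>)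
    also have "\<dots> = prob (A i) * prob {\<omega> \<in> space M. z * sqrt D \<le> B (s j) \<omega> - B (s i) \<omega>}"
      by (simp add: A_def P_def \<tau>_def)
    also have "\<dots> \<le> prob (A i) * (1 / (2 * real N))"
    proof (rule mult_left_mono)
      have "prob {\<omega> \<in> space M. z * sqrt D \<le> B (s j) \<omega> - B (s i) \<omega>} \<le> exp (- z\<^sup>2 / 2) / z"
        using D0 z1 s0[of i] sij
        by (intro normal_tail_le) (auto simp: D_def intro!: normal_increments)
      also have "\<dots> \<le> exp (- z\<^sup>2 / 2) / 1" using z1 by (intro divide_left_mono) auto
      also have "\<dots> = exp (- a\<^sup>2 / (64 * real (Suc N)))"
        using z2 by (simp only: div_by_1 minus_divide_left[symmetric])
      also have "\<dots> \<le> 1 / (2 * real N)" using tail i by (simp add: pos_le_divide_eq mult.commute)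
      finally show "prob {\<omega> \<in> space M. z * sqrt D \<le> B (s j) \<omega> - B (s i) \<omega>} \<le> 1 / (2 * real N)" .
    qed simp
    finally show ?thesis .
  qed
  have "real N * exp (- a\<^sup>2 / 2 - 3) / (2 * a) = (\<Sum>i\<in>{1..N}. exp (- a\<^sup>2 / 2 - 3) / a) / 2"
    by simp
  also have "\<dots> \<le> (\<Sum>i\<in>{1..N}. prob (A i)) / 2"
    by (intro divide_right_mono sum_mono A_ge) auto
  also have "\<dots> \<le> prob (\<Union>i\<in>{1..N}. A i)"
  proof (rule prob_Union_ge_half_sum)
    fix i assume i: "i \<in> {1..N}"
    have "(\<Sum>j\<in>{j\<in>{1..N}. i < j}. prob (A i \<inter> A j)) \<le> (\<Sum>j\<in>{j\<in>{1..N}. i < j}. prob (A i) * (1 / (2 * real N)))"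
      by (intro sum_mono pair) (use i in auto)
    also have "\<dots> \<le> (\<Sum>j\<in>{1..N}. prob (A i) * (1 / (2 * real N)))"
      by (intro sum_mono2) auto
    also have "\<dots> = prob (A i) / 2" using i by simp
    finally show "(\<Sum>j\<in>{j\<in>{1..N}. i < j}. prob (A i \<inter> A j)) \<le> prob (A i) / 2" .
  qed (use A_meas in auto)
  also have "\<dots> \<le> prob {\<omega> \<in> space M. \<exists>i\<in>{1..N}. a * sqrt (s i) \<le> B (s i) \<omega> - B T \<omega>}"
    by (rule finite_measure_mono) (auto simp: A_def)
  finally show ?thesis .
qed

text \<open>
  The blocks are independent, and each of them fails with probability at most
  \<open>1 - \<kappa> / (q + 1) \<le> exp (- \<kappa> / (q + 1))\<close>. The harmonic sum in the exponent of the product is bounded below by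
  a logarithm. The probability of a success behaves like \<open>1 / q\<close> because it contains the factor
  \<open>exp (- ln (ln s))\<close> and \<open>ln s\<close> is proportional to \<open>q\<close>.
\<close>

lemma no_success_prob_le:
  fixes r \<kappa> :: real and a :: "nat \<Rightarrow> real" and N q0 q1 :: nat
  defines "T \<equiv> \<lambda>q. exp (real q * r)"
  defines "s \<equiv> \<lambda>q i. T (Suc q) / 2 * (1 + real i / real (Suc N))"
  assumes r: "1 < r" and q01: "q0 \<le> q1" and \<kappa>: "0 \<le> \<kappa>"
    and a: "\<And>q. q \<in> {q0..<q1} \<Longrightarrow> 1 \<le> a q"
    and Ta: "\<And>q. q \<in> {q0..<q1} \<Longrightarrow> T q * ((a q)\<^sup>2 + 3) \<le> T (Suc q) / 4"
    and aN: "\<And>q. q \<in> {q0..<q1} \<Longrightarrow> 32 * real (Suc N) \<le> (a q)\<^sup>2"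
    and tail: "\<And>q. q \<in> {q0..<q1} \<Longrightarrow> 2 * real N * exp (- (a q)\<^sup>2 / (64 * real (Suc N))) \<le> 1"
    and p: "\<And>q. q \<in> {q0..<q1} \<Longrightarrow> \<kappa> / real (Suc q) \<le> real N * exp (- (a q)\<^sup>2 / 2 - 3) / (2 * a q)"
  shows "prob {\<omega> \<in> space M. \<forall>q\<in>{q0..<q1}. \<forall>i\<in>{1..N}.
        B (s q i) \<omega> - B (T q) \<omega> < a q * sqrt (s q i)}
      \<le> exp (- \<kappa> * (ln (real (Suc q1)) - ln (real (Suc q0))))"
proof -
  define L where "L = Suc N"
  have TS: "2 * T q < T (Suc q)" for q
  proof -
    have "2 < exp r" using exp_ge_add_one_self[of r] r by linarith
    moreover have "T (Suc q) = exp r * T q" by (simp add: T_def algebra_simps flip: exp_add)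
    ultimately show ?thesis by (simp add: T_def)
  qed
  have T0: "0 < T q" for q by (simp add: T_def)
  have s_ge: "T (Suc q) / 2 \<le> s q i" for q i
    using T0[of "Suc q"] by (simp add: s_def)
  have s_less: "s q i < T (Suc q)" if "i \<le> N" for q i
  proof -
    have "real i / real (Suc N) < 1" using that by simp
    then have "T (Suc q) / 2 * (1 + real i / real (Suc N)) < T (Suc q) / 2 * (1 + 1)"
      using T0[of "Suc q"] by (intro mult_strict_left_mono add_strict_left_mono) auto
    then show ?thesis by (simp add: s_def)
  qed
  \<comment> \<open>One sequence of times runs through all blocks: the start \<open>T q\<close> of block \<open>q\<close> and then its
    \<open>N\<close> points, so that a block takes \<open>L = N + 1\<close> places.\<close>
  define \<tau> where "\<tau> j = (if j mod L = 0 then T (j div L) else s (j div L) (j mod L))" for j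
  have \<tau>_T: "\<tau> (q * L) = T q" for q by (simp add: \<tau>_def L_def del: mult_Suc_right)
  have \<tau>_s: "\<tau> (q * L + i) = s q i" if "i \<in> {1..N}" for q i
  proof -
    have "i < L" "i \<noteq> 0" using that by (auto simp: L_def)
    then show ?thesis by (simp add: \<tau>_def)
  qed
  have \<tau>_step: "\<tau> j < \<tau> (Suc j)" for j
  proof (cases "Suc (j mod L) = L")
    case True
    then have "\<tau> (Suc j) = T (Suc (j div L))" by (simp add: \<tau>_def mod_Suc div_Suc)
    moreover have "\<tau> j < T (Suc (j div L))"
    proof -
      have "j mod L \<le> N" using True by (simp add: L_def)
      then show ?thesis
        using s_less[of "j mod L" "j div L"] TS[of "j div L"] T0[of "j div L"] by (auto simp: \<tau>_def)
    qed
    ultimately show ?thesis by simp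
  next
    case False
    then have eq: "\<tau> (Suc j) = s (j div L) (Suc (j mod L))" by (simp add: \<tau>_def mod_Suc div_Suc)
    show ?thesis
    proof (cases "j mod L = 0")
      case True
      then show ?thesis
        using eq s_ge[of "j div L" "Suc 0"] TS[of "j div L"] by (simp add: \<tau>_def)
    next
      case False
      have "s (j div L) (j mod L) < s (j div L) (Suc (j mod L))"
        unfolding s_def using T0 by (intro mult_strict_left_mono add_strict_left_mono divide_strict_right_mono) auto
      then show ?thesis using eq False by (simp add: \<tau>_def)
    qed
  qed
  have \<tau>0: "0 \<le> \<tau> 0" using T0[of 0] by (simp add: \<tau>_def less_imp_le)
  have s0: "0 \<le> s q i" for q i using s_ge[of q i] T0[of "Suc q"] by linarith
  define E where "E q = {\<omega> \<in> space M. \<exists>i\<in>{1..N}. a q * sqrt (s q i) \<le> B (s q i) \<omega> - B (T q) \<omega>}" for q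
  have incr [measurable]: "(\<lambda>\<omega>. B (s q i) \<omega> - B (T q) \<omega>) \<in> borel_measurable M" for q i
    using s0 T0[of q] by (intro increment_measurable) auto
  have E_meas: "E q \<in> events" for q unfolding E_def by measurable
  have "prob {\<omega> \<in> space M. \<forall>q\<in>{q0..<q1}. \<forall>i\<in>{1..N}.
        B (s q i) \<omega> - B (T q) \<omega> < a q * sqrt (s q i)}
      = (\<Prod>q\<in>{q0..<q1}. prob {\<omega> \<in> space M. \<forall>i\<in>{1..N}.
        B (s q i) \<omega> - B (T q) \<omega> < a q * sqrt (s q i)})"
  proof -
    have "N < L" by (simp add: L_def)
    from indep_blocks[OF \<tau>0 \<tau>_step this, of "{q0..<q1}" "\<lambda>q i. a q * sqrt (s q i)"]
    moreover have "(\<forall>i\<in>{1..N}. B (\<tau> (q * L + i)) \<omega> - B (\<tau> (q * L)) \<omega> < a q * sqrt (s q i))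
        \<longleftrightarrow> (\<forall>i\<in>{1..N}. B (s q i) \<omega> - B (T q) \<omega> < a q * sqrt (s q i))" for q \<omega>
      by (intro ball_cong refl) (simp only: \<tau>_T \<tau>_s)
    ultimately show ?thesis by (simp only: finite_atLeastLessThan)
  qed
  also have "\<dots> \<le> (\<Prod>q\<in>{q0..<q1}. exp (- \<kappa> * (1 / real (Suc q))))"
  proof (rule prod_mono, rule conjI)
    fix q assume q: "q \<in> {q0..<q1}"
    have "{\<omega> \<in> space M. \<forall>i\<in>{1..N}. B (s q i) \<omega> - B (T q) \<omega> < a q * sqrt (s q i)} = space M - E q"
      by (auto simp: E_def not_le)
    then have "prob {\<omega> \<in> space M. \<forall>i\<in>{1..N}. B (s q i) \<omega> - B (T q) \<omega> < a q * sqrt (s q i)} = 1 - prob (E q)"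
      using E_meas by (simp add: prob_compl)
    also have "\<dots> \<le> 1 - \<kappa> / real (Suc q)"
      using block_prob_ge[OF T0 a[OF q] Ta[OF q] aN[OF q] tail[OF q]] p[OF q]
      by (simp add: E_def s_def)
    also have "\<dots> \<le> exp (- \<kappa> * (1 / real (Suc q)))"
      using exp_ge_add_one_self[of "- \<kappa> * (1 / real (Suc q))"] by simp
    finally show "prob {\<omega> \<in> space M. \<forall>i\<in>{1..N}. B (s q i) \<omega> - B (T q) \<omega> < a q * sqrt (s q i)}
      \<le> exp (- \<kappa> * (1 / real (Suc q)))" .
  qed simp
  also have "\<dots> = exp (- \<kappa> * (\<Sum>q\<in>{q0..<q1}. 1 / real (Suc q)))"
    by (simp only: exp_sum[symmetric] finite_atLeastLessThan sum_distrib_left)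
  also have "\<dots> \<le> exp (- \<kappa> * (ln (real (Suc q1)) - ln (real (Suc q0))))"
  proof -
    have "ln (real (Suc q1)) - ln (real (Suc q0)) = (\<Sum>q\<in>{q0..<q1}. ln (real (Suc (Suc q))) - ln (real (Suc q)))"
      using q01 by (rule sum_Suc_diff'[symmetric])
    also have "\<dots> \<le> (\<Sum>q\<in>{q0..<q1}. 1 / real (Suc q))"
    proof (rule sum_mono)
      fix q
      have "1 + 1 / real (Suc q) = real (Suc (Suc q)) / real (Suc q)" by (simp add: field_simps)
      then have "ln (real (Suc (Suc q))) - ln (real (Suc q)) = ln (1 + 1 / real (Suc q))"
        by (simp only: ln_divide_pos of_nat_0_less_iff zero_less_Suc)
      also have "\<dots> \<le> 1 / real (Suc q)" by (rule ln_add_one_self_le_self) simp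
      finally show "ln (real (Suc (Suc q))) - ln (real (Suc q)) \<le> 1 / real (Suc q)" .
    qed
    finally show ?thesis using \<kappa> by (simp add: mult_left_mono)
  qed
  finally show ?thesis .
qed

lemma lower_tail_le:
  assumes t: "0 < t" and y: "0 < y"
  shows "prob {\<omega> \<in> space M. y * sqrt t \<le> B 0 \<omega> - B t \<omega>} \<le> exp (- y\<^sup>2 / 2) / y"
proof (rule normal_tail_le)
  have "distributed M lborel (\<lambda>\<omega>. B t \<omega> - B 0 \<omega>) (normal_density 0 (sqrt t))"
    using normal_increments[of 0 t] t by simp
  from normal_density_affine[OF this, of "-1" 0]
  show "distributed M lborel (\<lambda>\<omega>. B 0 \<omega> - B t \<omega>) (normal_density 0 (sqrt t))"
    using t by simp
qed (use t y in auto)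


text \<open>
  The conclusion asks for an excess at some scale beyond \<open>m\<close>, but measures it by \<open>ln m / m\<close>. The
  proof finds it among the scales between \<open>m\<close> and \<open>\<eta> * m\<close>. With \<open>r = 4 * ln m\<close>, consecutive block ends
  \<open>T q\<close> have ratio \<open>m ^ 4\<close>; this only costs a factor \<open>ln m\<close> in the number of blocks. The event \<open>S m\<close>
  is that no block has an excess, and \<open>H m\<close> is that some \<open>B (T q)\<close> is so negative that it could
  spoil one. Both probabilities are summable in \<open>m\<close>.
\<close>

lemma AE_eventually_blockwise_lower:
  fixes c :: real
  assumes c0: "0 < c" and c: "c < 3 / 4"
  shows "AE \<omega> in M. eventually (\<lambda>m. \<exists>s. exp 1 < s \<and> real m \<le> ln (ln s) \<and>
      1 + (c * ln (real m) - 1) / real m \<le> B s \<omega> / sqrt (2 * s * ln (ln s))) sequentially"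
proof -
  \<comment> \<open>Halfway between 1 and \<open>3 / (4 * c)\<close>, so that \<open>c * \<eta> < 3/4\<close>.\<close>
  define \<eta> where "\<eta> = (1 + 3 / (4 * c)) / 2"
  define b where "b = 2 * c * \<eta>"
  have \<eta>: "1 < \<eta>" using c0 c by (simp add: \<eta>_def field_simps)
  have "b = c + 3 / 4" using c0 by (simp add: b_def \<eta>_def field_simps)
  then have b: "0 < b" "b < 3 / 2" using c0 c by simp_all
  define g where "g m = 1 + c * ln (real m) / real m" for m :: nat
  define r where "r m = 4 * ln (real m)" for m :: nat
  \<comment> \<open>The factor \<open>100 * ln m\<close> makes the rise needed for a second excess in a block so rare that its
    probability is at most \<open>1 / m\<close> for each pair of points.\<close>
  define N where "N m = nat \<lfloor>real m / (100 * ln (real m))\<rfloor>" for m :: nat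
  \<comment> \<open>For \<open>q0 m \<le> q < q1 m\<close> the block from \<open>T q\<close> to \<open>T (q + 1)\<close> lies within the scales from
    \<open>m\<close> to \<open>\<eta> * m\<close>.\<close>
  define q0 where "q0 m = nat \<lceil>exp (real m) / r m\<rceil>" for m
  define q1 where "q1 m = nat \<lfloor>exp (\<eta> * real m) / r m\<rfloor>" for m
  define T where "T m q = exp (real q * r m)" for m q
  define s where "s m q i = T m (Suc q) / 2 * (1 + real i / real (Suc (N m)))" for m q i
  define a where "a m q = g m * sqrt (2 * ln (real (Suc q) * r m))" for m q
  \<comment> \<open>The bound of \<open>block_prob_ge\<close> without its factor \<open>1 / (q + 1)\<close>: a lower bound for the
    number of points, the rest of the Gaussian factor after \<open>exp (- ln (ln s))\<close> is taken out, and
    an upper bound for \<open>2 * a m q * r m\<close> in the denominator.\<close>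
  define \<kappa> where "\<kappa> m = real m / (200 * ln (real m)) * real m powr - b * exp (-4)
      / (16 * sqrt (2 * \<eta> * real m) * ln (real m))" for m
  define S where "S m = {\<omega> \<in> space M. \<forall>q\<in>{q0 m..<q1 m}. \<forall>i\<in>{1..N m}.
      B (s m q i) \<omega> - B (T m q) \<omega> < a m q * sqrt (s m q i)}" for m
  define H where "H m = {\<omega> \<in> space M. \<exists>q\<in>{q0 m..<q1 m}. real m * sqrt (T m q) \<le> B 0 \<omega> - B (T m q) \<omega>}" for m
  \<comment> \<open>The elementary inequalities, true for large \<open>m\<close>, that the estimates below rely on.\<close>
  define good where "good m \<longleftrightarrow> 3 \<le> m \<and>
      (g m)\<^sup>2 * \<eta> * real m - \<eta> * real m \<le> 2 * c * \<eta> * ln (real m) + 1 \<and> g m \<le> 2 \<and>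
      4 * (8 * \<eta> * real m + 3) \<le> real m ^ 4 \<and>
      real m / (200 * ln (real m)) \<le> real m / (100 * ln (real m)) - 1 \<and>
      real m / (100 * ln (real m)) + 1 \<le> real m / (50 * ln (real m)) \<and>
      32 * (real m / (50 * ln (real m))) \<le> 2 * real m \<and>
      exp (real m) / r m + 2 \<le> exp (\<eta> * real m) / r m \<and>
      (\<eta> - 1) * real m / 2 \<le> ln (exp (\<eta> * real m) / r m) - ln (exp (real m) / r m + 2)" for m
  have good: "eventually good sequentially"
    unfolding good_def g_def r_def
    by (intro eventually_conj eventually_ge_at_top; use c0 \<eta> in real_asymp)
  have T0: "0 < T m q" for m q by (simp add: T_def)
  have s0: "0 < s m q i" for m q i
    unfolding s_def using T0[of m "Suc q"] by (intro mult_pos_pos add_pos_nonneg) auto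
  have [measurable]: "(\<lambda>\<omega>. B (s m q i) \<omega> - B (T m q) \<omega>) \<in> borel_measurable M" 
    "(\<lambda>\<omega>. B 0 \<omega> - B (T m q) \<omega>) \<in> borel_measurable M" for m q i
    using s0[of m q i] T0[of m q] by (auto intro!: increment_measurable simp: less_imp_le)
  have S_meas: "S m \<in> events" for m unfolding S_def by measurable
  have H_meas: "H m \<in> events" for m unfolding H_def by measurable

  have range: "r m > 1 \<and> real m \<le> ln (real q * r m) \<and> real m \<le> ln (real (Suc q) * r m) \<and> ln (real (Suc q) * r m) \<le> \<eta> * real m"
    if m: "good m" and q: "q \<in> {q0 m..<q1 m}" for m q
  proof -
    have "exp 1 \<le> (3::real)" by (rule exp_le)
    then have "1 \<le> ln (real m)" using m by (simp add: good_def ln_ge_iff)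
    then have r: "1 < r m" by (simp add: r_def)
    have "exp (real m) / r m \<le> real q" using q by (auto simp: q0_def)
    then have "exp (real m) \<le> real q * r m" using r by (simp add: field_simps)
    moreover have "real q * r m \<le> real (Suc q) * r m" using r by simp
    moreover have "real (Suc q) \<le> exp (\<eta> * real m) / r m"
    proof -
      have "Suc q \<le> q1 m" using q by auto
      then have "real (Suc q) \<le> real (q1 m)" by (simp only: of_nat_le_iff)
      also have "\<dots> \<le> exp (\<eta> * real m) / r m" using r by (simp add: q1_def)
      finally show ?thesis .
    qed
    then have "real (Suc q) * r m \<le> exp (\<eta> * real m)" using r by (simp add: field_simps)
    ultimately show ?thesis
      using r exp_gt_zero[of "real m"]
      by (smt (verit) exp_ln ln_exp ln_le_cancel_iff)
  qed

  have exp_r: "exp (r m) = real m ^ 4" if m: "good m" for m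
  proof -
    have "r m = ln (real m ^ 4)" using m by (simp add: r_def good_def ln_realpow)
    then show ?thesis using m by (simp add: good_def)
  qed

  have S_le: "prob (S m) \<le> exp (- (\<kappa> m * ((\<eta> - 1) * real m / 2)))" if m: "good m" for m
  proof -
    have lnm: "1 \<le> ln (real m)"
      using m exp_le by (simp add: good_def ln_ge_iff)
    have m3: "3 \<le> m" using m by (simp add: good_def)
    have r: "1 < r m" using lnm by (simp add: r_def)
    have g1: "1 \<le> g m" using c0 lnm by (simp add: g_def)
    have g2: "g m \<le> 2" using m by (simp add: good_def)
    have \<kappa>0: "0 \<le> \<kappa> m" using lnm \<eta> by (simp add: \<kappa>_def)
    have N_ge: "real m / (200 * ln (real m)) \<le> real (N m)"
    proof -
      have "real m / (100 * ln (real m)) - 1 \<le> real (N m)" unfolding N_def by linarith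
      then show ?thesis using m by (simp add: good_def)
    qed
    have N_le: "real (Suc (N m)) \<le> real m / (50 * ln (real m))"
    proof -
      have "real (N m) \<le> real m / (100 * ln (real m))" using lnm by (simp add: N_def)
      then show ?thesis using m by (simp add: good_def)
    qed
    have q01: "q0 m \<le> q1 m"
    proof -
      have "\<lceil>exp (real m) / r m\<rceil> \<le> \<lfloor>exp (\<eta> * real m) / r m\<rfloor>"
        using m by (simp add: good_def le_floor_iff) linarith
      then show ?thesis unfolding q0_def q1_def by (rule nat_mono)
    qed
    have a2: "(a m q)\<^sup>2 = 2 * (g m)\<^sup>2 * ln (real (Suc q) * r m)" if q: "q \<in> {q0 m..<q1 m}" for q
    proof -
      have "0 \<le> ln (real (Suc q) * r m)" using range[OF m q] by linarith
      then show ?thesis by (simp add: a_def power_mult_distrib)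
    qed
    have a_lower: "2 * real m \<le> (a m q)\<^sup>2" and a_upper: "(a m q)\<^sup>2 \<le> 8 * \<eta> * real m"
      and a_pos: "0 \<le> a m q" if q: "q \<in> {q0 m..<q1 m}" for q
    proof -
      note R = range[OF m q]
      have l0: "0 \<le> ln (real (Suc q) * r m)" using R by linarith
      have "1\<^sup>2 \<le> (g m)\<^sup>2" "(g m)\<^sup>2 \<le> 2\<^sup>2"
        using g1 g2 by (intro power_mono; simp)+
      then have "2 * 1 * real m \<le> 2 * (g m)\<^sup>2 * ln (real (Suc q) * r m)"
        "2 * (g m)\<^sup>2 * ln (real (Suc q) * r m) \<le> 2 * 4 * (\<eta> * real m)"
        by (intro mult_mono; use R l0 \<open>1\<^sup>2 \<le> (g m)\<^sup>2\<close> \<open>(g m)\<^sup>2 \<le> 2\<^sup>2\<close> in simp)+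
      then show "2 * real m \<le> (a m q)\<^sup>2" "(a m q)\<^sup>2 \<le> 8 * \<eta> * real m"
        unfolding a2[OF q] by simp_all
      show "0 \<le> a m q" using g1 l0 by (simp add: a_def)
    qed
    have "prob (S m) \<le> exp (- \<kappa> m * (ln (real (Suc (q1 m))) - ln (real (Suc (q0 m)))))"
      unfolding S_def s_def T_def
    proof (rule no_success_prob_le[OF r q01 \<kappa>0])
      fix q assume q: "q \<in> {q0 m..<q1 m}"
      have "1\<^sup>2 \<le> (a m q)\<^sup>2" using a_lower[OF q] m3 by simp
      then show a1: "1 \<le> a m q" using a_pos[OF q] by (rule power2_le_imp_le)
      show "exp (real q * r m) * ((a m q)\<^sup>2 + 3) \<le> exp (real (Suc q) * r m) / 4"
      proof -
        note exp_r[OF m]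
        then have "(a m q)\<^sup>2 + 3 \<le> exp (r m) / 4"
          using m a_upper[OF q] by (simp add: good_def)
        then have "exp (real q * r m) * ((a m q)\<^sup>2 + 3) \<le> exp (real q * r m) * (exp (r m) / 4)"
          by (intro mult_left_mono) auto
        then show ?thesis by (simp add: algebra_simps flip: exp_add)
      qed
      show "32 * real (Suc (N m)) \<le> (a m q)\<^sup>2"
      proof -
        have "32 * real (Suc (N m)) \<le> 32 * (real m / (50 * ln (real m)))"
          using N_le by (intro mult_left_mono) auto
        also have "\<dots> \<le> 2 * real m" using m unfolding good_def by blast
        also note a_lower[OF q]
        finally show ?thesis .
      qed
      show "2 * real (N m) * exp (- (a m q)\<^sup>2 / (64 * real (Suc (N m)))) \<le> 1"
      proof -
        have "ln (real m) \<le> (a m q)\<^sup>2 / (64 * real (Suc (N m)))"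
        proof -
          have "ln (real m) * (64 * real (Suc (N m))) \<le> ln (real m) * (64 * (real m / (50 * ln (real m))))"
            using N_le lnm by (intro mult_left_mono) auto
          also have "\<dots> \<le> 2 * real m" using lnm by (simp add: field_simps)
          also note a_lower[OF q]
          finally show ?thesis by (simp add: pos_le_divide_eq del: of_nat_Suc)
        qed
        then have "exp (- (a m q)\<^sup>2 / (64 * real (Suc (N m)))) \<le> exp (- ln (real m))" by simp
        also have "\<dots> = 1 / real m" using m3 by (simp add: exp_minus inverse_eq_divide)
        finally have "2 * real (N m) * exp (- (a m q)\<^sup>2 / (64 * real (Suc (N m)))) \<le> 2 * real (N m) * (1 / real m)"
          by (intro mult_left_mono) auto
        moreover have "2 * real (N m) \<le> real m"
        proof -
          have "real m / (50 * ln (real m)) \<le> real m / 50"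
            using lnm by (intro divide_left_mono) auto
          then show ?thesis using N_le by simp
        qed
        then have "2 * real (N m) * (1 / real m) \<le> 1" using m3 by (simp add: field_simps)
        ultimately show ?thesis by linarith
      qed
      show "\<kappa> m / real (Suc q) \<le> real (N m) * exp (- (a m q)\<^sup>2 / 2 - 3) / (2 * a m q)"
      proof -
        note R = range[OF m q]
        define l where "l = ln (real (Suc q) * r m)"
        have l: "real m \<le> l" "l \<le> \<eta> * real m" using R by (auto simp: l_def)
        have "(a m q)\<^sup>2 / 2 = l + ((g m)\<^sup>2 - 1) * l" by (simp add: a2[OF q] l_def algebra_simps)
        also have "((g m)\<^sup>2 - 1) * l \<le> ((g m)\<^sup>2 - 1) * (\<eta> * real m)"
          using l g1 by (intro mult_left_mono) (auto simp: one_le_power)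
        also have "\<dots> \<le> b * ln (real m) + 1"
          using m by (simp add: good_def b_def algebra_simps)
        finally have "exp (- (l + (b * ln (real m) + 1)) - 3) \<le> exp (- (a m q)\<^sup>2 / 2 - 3)" by simp
        moreover have "exp (- (l + (b * ln (real m) + 1)) - 3) = 1 / (real (Suc q) * r m) * (real m powr - b * exp (-4))"
        proof -
          have "exp (- l) = 1 / (real (Suc q) * r m)"
            using r by (simp add: l_def exp_minus inverse_eq_divide)
          moreover have "exp (- (b * ln (real m))) = real m powr - b"
            using m3 by (simp add: powr_def)
          moreover have "- (l + (b * ln (real m) + 1)) - 3 = - l + (- (b * ln (real m)) + -4)" by simp
          ultimately show ?thesis by (simp only: exp_add)
        qed
        ultimately have e: "1 / (real (Suc q) * r m) * (real m powr - b * exp (-4)) \<le> exp (- (a m q)\<^sup>2 / 2 - 3)"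
          by (simp only:)
        have "(a m q) \<le> 2 * sqrt (2 * \<eta> * real m)"
        proof (rule power2_le_imp_le)
          show "(a m q)\<^sup>2 \<le> (2 * sqrt (2 * \<eta> * real m))\<^sup>2"
            using a_upper[OF q] \<eta> by (simp add: power_mult_distrib)
        qed (use \<eta> in simp)
        then have a4: "2 * a m q \<le> 4 * sqrt (2 * \<eta> * real m)" by simp
        have "\<kappa> m / real (Suc q) = (real m / (200 * ln (real m)))
           * (1 / (real (Suc q) * r m) * (real m powr - b * exp (-4))) / (4 * sqrt (2 * \<eta> * real m))"
          by (simp add: \<kappa>_def r_def mult_ac)
        also have "\<dots> \<le> real (N m) * exp (- (a m q)\<^sup>2 / 2 - 3) / (2 * a m q)"
        proof (rule frac_le)
          show "(real m / (200 * ln (real m))) * (1 / (real (Suc q) * r m) * (real m powr - b * exp (-4)))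
              \<le> real (N m) * exp (- (a m q)\<^sup>2 / 2 - 3)"
            using N_ge e r lnm by (intro mult_mono) auto
        qed (use a4 a1 in auto)
        finally show ?thesis .
      qed
    qed
    also have "\<dots> \<le> exp (- (\<kappa> m * ((\<eta> - 1) * real m / 2)))"
    proof -
      have "0 < exp (real m) / r m" using r by simp
      then have "real (Suc (q0 m)) \<le> exp (real m) / r m + 2"
        unfolding q0_def by linarith
      then have "ln (real (Suc (q0 m))) \<le> ln (exp (real m) / r m + 2)"
        using r by (subst ln_le_cancel_iff) (auto intro!: add_nonneg_pos)
      moreover have "exp (\<eta> * real m) / r m \<le> real (Suc (q1 m))"
        unfolding q1_def by linarith
      then have "ln (exp (\<eta> * real m) / r m) \<le> ln (real (Suc (q1 m)))"
        using r by (subst ln_le_cancel_iff) auto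
      ultimately have "(\<eta> - 1) * real m / 2 \<le> ln (real (Suc (q1 m))) - ln (real (Suc (q0 m)))"
        using m unfolding good_def by linarith
      from mult_left_mono[OF this \<kappa>0] show ?thesis by simp
    qed
    finally show ?thesis .
  qed

  have H_le: "prob (H m) \<le> exp (\<eta> * real m) * exp (- (real m)\<^sup>2 / 2)" if m: "good m" for m
  proof -
    have lnm: "1 \<le> ln (real m)"
      using m exp_le by (simp add: good_def ln_ge_iff)
    have m3: "3 \<le> m" using m by (simp add: good_def)
    have r: "1 < r m" using lnm by (simp add: r_def)
    have "H m = (\<Union>q\<in>{q0 m..<q1 m}. {\<omega> \<in> space M. real m * sqrt (T m q) \<le> B 0 \<omega> - B (T m q) \<omega>})"
      by (auto simp: H_def)
    then have "prob (H m) \<le> (\<Sum>q\<in>{q0 m..<q1 m}. prob {\<omega> \<in> space M. real m * sqrt (T m q) \<le> B 0 \<omega> - B (T m q) \<omega>})"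
      by (simp only:) (rule finite_measure_subadditive_finite; auto)
    also have "\<dots> \<le> (\<Sum>q\<in>{q0 m..<q1 m}. exp (- (real m)\<^sup>2 / 2))"
    proof (rule sum_mono)
      fix q
      have "prob {\<omega> \<in> space M. real m * sqrt (T m q) \<le> B 0 \<omega> - B (T m q) \<omega>} \<le> exp (- (real m)\<^sup>2 / 2) / real m"
        using m3 by (intro lower_tail_le T0) simp
      also have "\<dots> \<le> exp (- (real m)\<^sup>2 / 2) / 1"
        using m3 by (intro divide_left_mono) auto
      finally show "prob {\<omega> \<in> space M. real m * sqrt (T m q) \<le> B 0 \<omega> - B (T m q) \<omega>} \<le> exp (- (real m)\<^sup>2 / 2)"
        by simp
    qed
    also have "\<dots> = real (q1 m - q0 m) * exp (- (real m)\<^sup>2 / 2)" by simp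
    also have "\<dots> \<le> exp (\<eta> * real m) * exp (- (real m)\<^sup>2 / 2)"
    proof (rule mult_right_mono)
      have "real (q1 m - q0 m) \<le> real (q1 m)" by simp
      also have "\<dots> \<le> exp (\<eta> * real m) / r m" using r by (simp add: q1_def)
      also have "\<dots> \<le> exp (\<eta> * real m) / 1" using r by (intro divide_left_mono) auto
      finally show "real (q1 m - q0 m) \<le> exp (\<eta> * real m)" by simp
    qed simp
    finally show ?thesis .
  qed

  have "summable (\<lambda>m. exp (- (\<kappa> m * ((\<eta> - 1) * real m / 2))) + exp (\<eta> * real m) * exp (- (real m)\<^sup>2 / 2))"
  proof (rule summable_comparison_test_bigo)
    show "summable (\<lambda>m. norm (real m powr (-2)))"
      by (simp add: summable_real_powr_iff)
    show "(\<lambda>m. exp (- (\<kappa> m * ((\<eta> - 1) * real m / 2))) + exp (\<eta> * real m) * exp (- (real m)\<^sup>2 / 2))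
        \<in> O(\<lambda>m. real m powr (-2))"
    proof (rule sum_in_bigo)
      show "(\<lambda>m. exp (- (\<kappa> m * ((\<eta> - 1) * real m / 2)))) \<in> O(\<lambda>m. real m powr (-2))"
        unfolding \<kappa>_def using b \<eta> by real_asymp
      show "(\<lambda>m. exp (\<eta> * real m) * exp (- (real m)\<^sup>2 / 2)) \<in> O(\<lambda>m. real m powr (-2))"
        using \<eta> by real_asymp
    qed
  qed
  moreover have "eventually (\<lambda>m. norm (prob (S m \<union> H m))
      \<le> exp (- (\<kappa> m * ((\<eta> - 1) * real m / 2))) + exp (\<eta> * real m) * exp (- (real m)\<^sup>2 / 2)) sequentially"
    using good
  proof eventually_elim
    case (elim m)
    then show ?case
      using S_le[OF elim] H_le[OF elim] measure_Un_le[OF S_meas H_meas, of m m] by simp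
  qed
  ultimately have "summable (\<lambda>m. prob (S m \<union> H m))"
    by (rule summable_comparison_test_ev[rotated])
  then have "AE \<omega> in M. eventually (\<lambda>m. \<omega> \<in> space M - (S m \<union> H m)) sequentially"
    using S_meas H_meas by (intro borel_cantelli_AE1) (auto simp: emeasure_eq_measure)
  then show ?thesis
    using start_zero
  proof eventually_elim
    case (elim \<omega>)
    from elim(1) good show ?case
    proof eventually_elim
      fix m assume \<omega>: "\<omega> \<in> space M - (S m \<union> H m)" and m: "good m"
      from \<omega> obtain q i where q: "q \<in> {q0 m..<q1 m}" and i: "i \<in> {1..N m}"
        and large: "a m q * sqrt (s m q i) \<le> B (s m q i) \<omega> - B (T m q) \<omega>"
        by (auto simp: S_def not_less)
      have Tq: "- (real m * sqrt (T m q)) < B (T m q) \<omega>"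
      proof -
        have "\<not> real m * sqrt (T m q) \<le> B 0 \<omega> - B (T m q) \<omega>"
          using \<omega> q by (auto simp: H_def)
        then show ?thesis using elim(2) by linarith
      qed
      have lnm: "1 \<le> ln (real m)"
        using m exp_le by (simp add: good_def ln_ge_iff)
      have m3: "3 \<le> m" using m by (simp add: good_def)
      have g1: "1 \<le> g m" using c0 lnm by (simp add: g_def)
      note R = range[OF m q]
      let ?s = "s m q i"
      have T_Suc: "T m (Suc q) = real m ^ 4 * T m q"
      proof -
        have "real m ^ 4 = exp (r m)" using exp_r[OF m] by simp
        then show ?thesis by (simp add: T_def algebra_simps flip: exp_add)
      qed
      have s_lower: "T m (Suc q) / 2 \<le> ?s"
        using T0[of m "Suc q"] by (simp add: s_def)
      have s_upper: "?s \<le> T m (Suc q)"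
      proof -
        have "real i / real (Suc (N m)) \<le> 1" using i by simp
        then have "T m (Suc q) / 2 * (1 + real i / real (Suc (N m))) \<le> T m (Suc q) / 2 * (1 + 1)"
          using T0[of m "Suc q"] by (intro mult_left_mono add_left_mono) auto
        then show ?thesis by (simp add: s_def)
      qed
      have "3 ^ 4 \<le> real m ^ 4" using m3 by (intro power_mono) auto
      then have "2 * T m q \<le> T m (Suc q)"
        unfolding T_Suc using T0[of m q] by (intro mult_right_mono) auto
      then have Ts: "T m q \<le> ?s" using s_lower by simp
      have ln_s: "real q * r m \<le> ln ?s" "ln ?s \<le> real (Suc q) * r m"
        using Ts s_upper s0[of m q i] T0
        by (metis T_def ln_exp ln_le_cancel_iff)+
      have qr: "exp (real m) \<le> real q * r m"
      proof -
        have "0 < real q * r m" using R m3 by (cases "q = 0") auto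
        then show ?thesis using R by (metis exp_le_cancel_iff exp_ln)
      qed
      have ln_s0: "1 < ln ?s"
      proof -
        have "1 < exp (real m)" using m3 by simp
        then show ?thesis using ln_s qr by linarith
      qed
      have l1: "real m \<le> ln (ln ?s)"
        using qr ln_s ln_s0 by (subst ln_ge_iff) auto
      have l2: "ln (ln ?s) \<le> ln (real (Suc q) * r m)"
        using ln_s ln_s0 by (subst ln_le_cancel_iff) auto
      have "exp 1 < ?s"
        using ln_s0 s0[of m q i] by (metis exp_less_cancel_iff exp_ln)
      moreover have "1 + (c * ln (real m) - 1) / real m \<le> B ?s \<omega> / sqrt (2 * ?s * ln (ln ?s))"
      proof -
        \<comment> \<open>Here the ratio \<open>m ^ 4\<close> is used: the contribution of \<open>B (T q)\<close> is at most of relative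
          size \<open>1 / m\<close>, which is the loss \<open>- 1\<close> in the numerator of the claim.\<close>
        have sq: "real m * sqrt (T m q) \<le> sqrt 2 / real m * sqrt ?s"
        proof (rule power2_le_imp_le)
          have "(real m * sqrt (T m q))\<^sup>2 = (2 / (real m)\<^sup>2) * (T m (Suc q) / 2)"
            using T0[of m q] m3 by (simp add: T_Suc power_mult_distrib field_simps)
          also have "\<dots> \<le> (2 / (real m)\<^sup>2) * ?s"
            using s_lower by (intro mult_left_mono) auto
          also have "\<dots> = (sqrt 2 / real m * sqrt ?s)\<^sup>2"
            using s0[of m q i] by (simp add: power_mult_distrib power_divide)
          finally show "(real m * sqrt (T m q))\<^sup>2 \<le> (sqrt 2 / real m * sqrt ?s)\<^sup>2" .
        qed (use s0[of m q i] in simp)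
        have "(g m - 1 / real m) * sqrt (2 * ?s * ln (ln ?s)) \<le> B ?s \<omega>"
        proof -
          have "g m * sqrt (2 * ln (ln ?s)) \<le> a m q"
            unfolding a_def using g1 l2 by (intro mult_left_mono) auto
          moreover have "sqrt 2 / real m \<le> 1 / real m * sqrt (2 * ln (ln ?s))"
          proof -
            have "2 \<le> 2 * ln (ln ?s)" using l1 m3 by simp
            then have "1 / real m * sqrt 2 \<le> 1 / real m * sqrt (2 * ln (ln ?s))"
              by (intro mult_left_mono) auto
            then show ?thesis by simp
          qed
          ultimately have "(g m - 1 / real m) * sqrt (2 * ln (ln ?s)) \<le> a m q - sqrt 2 / real m"
            unfolding left_diff_distrib by linarith
          then have "(g m - 1 / real m) * sqrt (2 * ln (ln ?s)) * sqrt ?s \<le> (a m q - sqrt 2 / real m) * sqrt ?s"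
            using s0[of m q i] by (intro mult_right_mono) auto
          also have "\<dots> \<le> B ?s \<omega>"
            unfolding left_diff_distrib using large Tq sq by linarith
          finally show ?thesis by (simp add: real_sqrt_mult mult_ac)
        qed
        moreover have "0 < sqrt (2 * ?s * ln (ln ?s))" using s0[of m q i] l1 m3 by simp
        moreover have "1 + (c * ln (real m) - 1) / real m = g m - 1 / real m"
          by (simp add: g_def diff_divide_distrib)
        ultimately show ?thesis by (simp add: pos_le_divide_eq)
      qed
      ultimately show "\<exists>s. exp 1 < s \<and> real m \<le> ln (ln s) \<and>
          1 + (c * ln (real m) - 1) / real m \<le> B s \<omega> / sqrt (2 * s * ln (ln s))"
        using l1 by blast
    qed
  qed
qed

end

section \<open>From blocks of scales to the limit\<close>

lemma iterated_ln_2: "iterated_ln 2 t = ln (ln t)"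
  and iterated_ln_3: "iterated_ln 3 t = ln (ln (ln t))"
  by (simp_all add: iterated_ln_def numeral_eq_Suc)

lemma eventually_ln_ln:
  assumes "eventually P at_top"
  shows "eventually (\<lambda>t::real. P (ln (ln t))) at_top"
proof -
  have "filterlim (\<lambda>t::real. ln (ln t)) at_top at_top" by real_asymp
  then show ?thesis using assms by (rule eventually_compose_filterlim[rotated])
qed

text \<open>
  For \<open>s \<ge> t\<close> the bound at the integer scale \<open>m\<close> just below \<open>ln (ln s)\<close> is at most the one for
  \<open>ln (ln t) - 1\<close>, since \<open>ln x / x\<close> decreases for \<open>x \<ge> exp 1\<close>. So a single bound controls the whole
  supremum.
\<close>

lemma limsup_from_blocks:
  fixes b :: "real \<Rightarrow> real" and c l :: real
  assumes c: "0 < c" "c < l"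
    and blocks: "eventually (\<lambda>m. \<forall>s. exp 1 < s \<longrightarrow> real m \<le> ln (ln s) \<longrightarrow> ln (ln s) \<le> real m + 1
      \<longrightarrow> b s \<le> sqrt s * sqrt (2 * real m) * (1 + c * ln (real m) / real m)) sequentially"
  shows "eventually (\<lambda>t. ereal (iterated_ln 2 t / iterated_ln 3 t) *
      ((SUP s\<in>{t..}. ereal (b s / sqrt (2 * s * iterated_ln 2 s))) - 1) < ereal l) at_top"
proof -
  obtain m0 where m0: "\<And>m s. m0 \<le> m \<Longrightarrow> exp 1 < s \<Longrightarrow> real m \<le> ln (ln s) \<Longrightarrow> ln (ln s) \<le> real m + 1
      \<Longrightarrow> b s \<le> sqrt s * sqrt (2 * real m) * (1 + c * ln (real m) / real m)"
    using blocks by (auto simp: eventually_sequentially)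
  have "eventually (\<lambda>x::real. x / ln x * (c * ln x / (x - 1)) < l) at_top"
    using c by real_asymp
  from eventually_ln_ln[OF this] have "eventually (\<lambda>t::real. ln (ln t) / ln (ln (ln t)) *
      (c * ln (ln (ln t)) / (ln (ln t) - 1)) < l) at_top" .
  moreover have "eventually (\<lambda>t::real. real m0 + 4 \<le> ln (ln t)) at_top"
    by (rule eventually_ln_ln) (rule eventually_ge_at_top)
  moreover have "eventually (\<lambda>t::real. exp 1 < t) at_top"
    by (rule eventually_gt_at_top)
  ultimately show ?thesis
  proof eventually_elim
    case (elim t)
    define x where "x = ln (ln t)"
    have x: "real m0 + 4 \<le> x" using elim by (simp add: x_def)
    have lnx: "0 < ln x" using x by simp
    have "ereal (b s / sqrt (2 * s * iterated_ln 2 s)) \<le> ereal (1 + c * ln x / (x - 1))" if s: "t \<le> s" for s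
    proof -
      define y where "y = ln (ln s)"
      have s1: "exp 1 < s" using s elim by linarith
      then have s0: "0 < s" using exp_gt_zero[of "1::real"] by linarith
      have lt: "1 < ln t" using elim(3) by (metis exp_gt_zero exp_less_cancel_iff exp_ln less_trans)
      have "x \<le> y"
        unfolding x_def y_def using s lt elim(3) s0
        by (smt (verit) exp_gt_zero ln_le_cancel_iff)
      define m where "m = nat \<lfloor>y\<rfloor>"
      have m: "real m \<le> y" "y < real m + 1"
        unfolding m_def using x \<open>x \<le> y\<close> by linarith+
      have mx: "x - 1 \<le> real m" using m \<open>x \<le> y\<close> by linarith
      have m3: "3 \<le> x - 1" using x by simp
      have "b s \<le> sqrt s * sqrt (2 * real m) * (1 + c * ln (real m) / real m)"
        using m0[of m s] s1 m mx x by (simp add: y_def)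
      also have "\<dots> \<le> sqrt s * sqrt (2 * y) * (1 + c * ln (real m) / real m)"
        using m mx m3 c s0 by (intro mult_right_mono mult_left_mono add_nonneg_nonneg) auto
      also have "\<dots> \<le> sqrt s * sqrt (2 * y) * (1 + c * ln x / (x - 1))"
      proof (intro mult_left_mono add_left_mono)
        have "exp 1 \<le> x - 1" using m3 exp_le by linarith
        then have "ln (real m) / real m \<le> ln (x - 1) / (x - 1)"
          using mx by (rule ln_x_over_x_mono)
        also have "\<dots> \<le> ln x / (x - 1)" using m3 by (intro divide_right_mono) auto
        finally have "c * (ln (real m) / real m) \<le> c * (ln x / (x - 1))" using c by (intro mult_left_mono) auto
        then show "c * ln (real m) / real m \<le> c * ln x / (x - 1)" by simp
      qed (use s0 m mx m3 in auto)
      finally have "b s \<le> (1 + c * ln x / (x - 1)) * sqrt (2 * s * y)"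
        by (simp add: real_sqrt_mult mult_ac)
      moreover have "0 < sqrt (2 * s * y)" using s0 m mx m3 by simp
      ultimately show ?thesis by (simp add: iterated_ln_2 y_def pos_divide_le_eq)
    qed
    then have "(SUP s\<in>{t..}. ereal (b s / sqrt (2 * s * iterated_ln 2 s))) \<le> ereal (1 + c * ln x / (x - 1))"
      by (intro SUP_least) auto
    then have "(SUP s\<in>{t..}. ereal (b s / sqrt (2 * s * iterated_ln 2 s))) - 1 \<le> ereal (1 + c * ln x / (x - 1)) - 1"
      by (rule ereal_minus_mono) simp
    also have "\<dots> = ereal (c * ln x / (x - 1))" by (simp add: one_ereal_def)
    finally have "ereal (x / ln x) * ((SUP s\<in>{t..}. ereal (b s / sqrt (2 * s * iterated_ln 2 s))) - 1)
        \<le> ereal (x / ln x) * ereal (c * ln x / (x - 1))"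
      using x lnx by (intro ereal_mult_left_mono) auto
    also have "\<dots> < ereal l" using elim(1) by (simp add: x_def)
    finally show ?case by (simp add: iterated_ln_2 iterated_ln_3 x_def)
  qed
qed

text \<open>
  The witness at the integer scale \<open>m\<close> just above \<open>ln (ln t)\<close> is a time beyond \<open>t\<close>, and \<open>m\<close> exceeds
  \<open>ln (ln t)\<close> by at most 1, which does not matter in the limit.
\<close>

lemma liminf_from_blocks:
  fixes b :: "real \<Rightarrow> real" and c l :: real
  assumes c: "0 < c" "l < c"
    and blocks: "eventually (\<lambda>m. \<exists>s. exp 1 < s \<and> real m \<le> ln (ln s) \<and>
      1 + (c * ln (real m) - 1) / real m \<le> b s / sqrt (2 * s * ln (ln s))) sequentially"
  shows "eventually (\<lambda>t. ereal l < ereal (iterated_ln 2 t / iterated_ln 3 t) *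
      ((SUP s\<in>{t..}. ereal (b s / sqrt (2 * s * iterated_ln 2 s))) - 1)) at_top"
proof -
  obtain m0 where m0: "\<And>m. m0 \<le> m \<Longrightarrow> \<exists>s. exp 1 < s \<and> real m \<le> ln (ln s) \<and>
      1 + (c * ln (real m) - 1) / real m \<le> b s / sqrt (2 * s * ln (ln s))"
    using blocks by (auto simp: eventually_sequentially)
  have "eventually (\<lambda>x::real. l < x / ln x * ((c * ln x - 1) / (x + 1))) at_top"
    using c by real_asymp
  from eventually_ln_ln[OF this] have "eventually (\<lambda>t::real. l < ln (ln t) / ln (ln (ln t)) *
      ((c * ln (ln (ln t)) - 1) / (ln (ln t) + 1))) at_top" .
  moreover have "eventually (\<lambda>x::real. 1 \<le> c * ln x) at_top"
    using c by real_asymp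
  from eventually_ln_ln[OF this] have "eventually (\<lambda>t::real. 1 \<le> c * ln (ln (ln t))) at_top" .
  moreover have "eventually (\<lambda>t::real. real m0 + 4 \<le> ln (ln t)) at_top"
    by (rule eventually_ln_ln) (rule eventually_ge_at_top)
  moreover have "eventually (\<lambda>t::real. exp 1 < t) at_top"
    by (rule eventually_gt_at_top)
  ultimately show ?thesis
  proof eventually_elim
    case (elim t)
    define x where "x = ln (ln t)"
    have x: "real m0 + 4 \<le> x" and cx: "1 \<le> c * ln x" using elim by (simp_all add: x_def)
    have lnx: "0 < ln x" using x by simp
    define m where "m = nat \<lceil>x\<rceil>"
    have m: "x \<le> real m" "real m \<le> x + 1"
      unfolding m_def using x by linarith+
    have "m0 \<le> m" using m x by linarith
    from m0[OF this] obtain s where s: "exp 1 < s" "real m \<le> ln (ln s)"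
      "1 + (c * ln (real m) - 1) / real m \<le> b s / sqrt (2 * s * ln (ln s))" by blast
    have "t \<le> s"
    proof (rule ccontr)
      assume "\<not> t \<le> s"
      then have st: "s < t" by simp
      have s0: "0 < s" using s(1) exp_gt_zero[of "1::real"] by linarith
      have "1 < ln s" using s(1) s0 by (metis exp_less_cancel_iff exp_ln)
      moreover have "ln s < ln t" using st s0 by simp
      ultimately have "ln (ln s) < x" by (simp add: x_def)
      with s(2) m show False by linarith
    qed
    have "(c * ln x - 1) / (x + 1) \<le> (c * ln (real m) - 1) / real m"
    proof (rule frac_le)
      show "c * ln x - 1 \<le> c * ln (real m) - 1" using m x c by simp
      then show "0 \<le> c * ln (real m) - 1" using cx by linarith
    qed (use m x in auto)
    then have "ereal (1 + (c * ln x - 1) / (x + 1)) \<le> ereal (b s / sqrt (2 * s * iterated_ln 2 s))"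
      using s(3) by (simp add: iterated_ln_2)
    also have "\<dots> \<le> (SUP s\<in>{t..}. ereal (b s / sqrt (2 * s * iterated_ln 2 s)))"
      by (rule SUP_upper) (use \<open>t \<le> s\<close> in simp)
    finally have "ereal (1 + (c * ln x - 1) / (x + 1)) - 1
        \<le> (SUP s\<in>{t..}. ereal (b s / sqrt (2 * s * iterated_ln 2 s))) - 1"
      by (rule ereal_minus_mono) simp
    moreover have "ereal (1 + (c * ln x - 1) / (x + 1)) - 1 = ereal ((c * ln x - 1) / (x + 1))"
      by (simp add: one_ereal_def)
    ultimately have "ereal (x / ln x) * ereal ((c * ln x - 1) / (x + 1))
        \<le> ereal (x / ln x) * ((SUP s\<in>{t..}. ereal (b s / sqrt (2 * s * iterated_ln 2 s))) - 1)"
      using x lnx by (intro ereal_mult_left_mono) auto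
    moreover have "ereal l < ereal (x / ln x) * ereal ((c * ln x - 1) / (x + 1))"
      using elim(1) by (simp add: x_def)
    ultimately show ?case
      by (simp only: iterated_ln_2 iterated_ln_3 x_def)
  qed
qed

theorem theorem1p2:
  fixes M :: "'a measure" and B :: "real \<Rightarrow> 'a \<Rightarrow> real"
  assumes "standard_brownian_motion M B"
  shows "AE \<omega> in M.
    ((\<lambda>t. ereal (iterated_ln 2 t / iterated_ln 3 t) *
            ((SUP s\<in>{t..}. ereal (B s \<omega> / sqrt (2 * s * iterated_ln 2 s))) - 1))
      \<longlongrightarrow> ereal (3 / 4)) at_top"
proof -
  interpret standard_brownian_motion M B by fact
  let ?up = "\<lambda>n::nat. 3 / 4 + 1 / real (Suc n)" and ?lo = "\<lambda>n::nat. 3 / 4 - 1 / real (Suc (Suc n))"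
  have "AE \<omega> in M. \<forall>n. eventually (\<lambda>m. \<forall>s. exp 1 < s \<longrightarrow> real m \<le> ln (ln s) \<longrightarrow> ln (ln s) \<le> real m + 1
      \<longrightarrow> B s \<omega> \<le> sqrt s * sqrt (2 * real m) * (1 + ?up n * ln (real m) / real m)) sequentially"
    unfolding AE_all_countable by (intro allI AE_eventually_blockwise_upper) simp
  moreover have "AE \<omega> in M. \<forall>n. eventually (\<lambda>m. \<exists>s. exp 1 < s \<and> real m \<le> ln (ln s) \<and>
      1 + (?lo n * ln (real m) - 1) / real m \<le> B s \<omega> / sqrt (2 * s * ln (ln s))) sequentially"
    unfolding AE_all_countable
    by (intro allI AE_eventually_blockwise_lower) (auto simp: field_simps)
  ultimately show ?thesis
  proof eventually_elim
    case (elim \<omega>)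
    show ?case
    proof (rule order_tendstoI)
      fix a :: ereal assume "a < ereal (3 / 4)"
      then obtain l where l: "a < ereal l" "l < 3 / 4" using ereal_dense2 by force
      have "?lo \<longlonglongrightarrow> 3 / 4" by real_asymp
      from order_tendstoD(1)[OF this l(2)] obtain n where n: "l < ?lo n"
        by (auto simp: eventually_sequentially)
      have "0 < ?lo n" by (auto simp: field_simps)
      from liminf_from_blocks[OF this n elim(2)[rule_format]]
      show "eventually (\<lambda>t. a < ereal (iterated_ln 2 t / iterated_ln 3 t) *
            ((SUP s\<in>{t..}. ereal (B s \<omega> / sqrt (2 * s * iterated_ln 2 s))) - 1)) at_top"
        by (rule eventually_mono) (use l(1) in \<open>rule less_trans\<close>)
    next
      fix a :: ereal assume "ereal (3 / 4) < a"
      then obtain l where l: "ereal l < a" "3 / 4 < l" using ereal_dense2 by force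
      have "?up \<longlonglongrightarrow> 3 / 4" by real_asymp
      from order_tendstoD(2)[OF this l(2)] obtain n where n: "?up n < l"
        by (auto simp: eventually_sequentially)
      have "0 < ?up n" by (simp add: add_pos_pos)
      from limsup_from_blocks[OF this n elim(1)[rule_format]]
      show "eventually (\<lambda>t. ereal (iterated_ln 2 t / iterated_ln 3 t) *
            ((SUP s\<in>{t..}. ereal (B s \<omega> / sqrt (2 * s * iterated_ln 2 s))) - 1) < a) at_top"
        by (rule eventually_mono) (use l(1) in \<open>rule less_trans[rotated]\<close>)
    qed
  qed
qed

end
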